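(* Let $X$ be a heap, let $e\in X$, and regard $X$ as a group $G$ with multiplication $xy=[x,e,y]$. Let $\bar\Psi_n:H^G_n(X)\to H^{(0)}_n(X)$ be the map induced on homology by $\Psi_n(x_1,\dots,x_n)=(x_1,e,x_2,e,\dots,e,x_n)$. Then $\bar\Psi_n$ is injective for all $n$. Furthermore, there is a long exact sequence of homology groups $$\cdots\to H^G_n(X)\to H^{(0)}_n(X)\to\widetilde H^{(0)}_n(X)\xrightarrow{\ \partial\ }H^G_{n-1}(X)\to\cdots .$$
   Context: A heap is a non-empty set $X$ with a ternary operation $[x,y,z]$ satisfying $[[x_1,x_2,x_3],x_4,x_5]=[x_1,[x_4,x_3,x_2],x_5]=[x_1,x_2,[x_3,x_4,x_5]]$, $[x,x,y]=y$ and $[x,y,y]=x$. For $e\in X$, the product $xy=[x,e,y]$ makes $X$ a group with identity $e$. Type 0 para-associative homology: for $n\ge1$, $C^{(0)}_n(X)$ is the free abelian group on tuples $(x_1,\dots,x_{2n-1})\in X^{2n-1}$. The boundary $\partial^{(0)}_n:C^{(0)}_n(X)\to C^{(0)}_{n-1}(X)$ is, for $n\ge3$, $$\partial^{(0)}_n(x_1,\dots,x_{2n-1})=-(x_3,\dots,x_{2n-1})+\sum_{i=1}^{n-1}(-1)^{i+1}(x_1,\dots,x_{2i-2},[x_{2i-1},x_{2i},x_{2i+1}],x_{2i+2},\dots,x_{2n-1})+(-1)^{n+1}(x_1,\dots,x_{2n-3}),$$ and $\partial^{(0)}_2(x_1,x_2,x_3)=([x_1,x_2,x_3])-(x_1)+(x_2)-(x_3)$.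 Its homology is $H^{(0)}_n(X)$. Group homology: $H^G_n(X)$ is the homology of the group $G$ with trivial integer coefficients, computed from the inhomogeneous complex in which $C^G_n$ is the free abelian group on $n$-tuples of elements of $G$ and (with the sign convention matching the formula above) $\partial_n(x_1,\dots,x_n)=-(x_2,\dots,x_n)+\sum_{i=1}^{n-1}(-1)^{i+1}(x_1,\dots,x_ix_{i+1},\dots,x_n)+(-1)^{n+1}(x_1,\dots,x_{n-1})$. Relative groups: $\widehat C^{(0)}_n(X)\subset C^{(0)}_n(X)$ is the subgroup freely generated by tuples with $x_{2i}=e$ for $i=1,\dots,n-1$ (so $\widehat C^{(0)}_1(X)=C^{(0)}_1(X)$); these form a subcomplex, and $\widetilde H^{(0)}_n(X)$ is the homology of the quotient complex $C^{(0)}_\bullet(X)/\widehat C^{(0)}_\bullet(X)$.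
   Formalization: With the given boundary in degree 2, the induced map does not exist for n=1 and exactness at H^(0)_1, H^(0)_2 fails; exactness is proved at H^(0)_n for n≥3 (n=2: composite zero), at H^G_n for n≥2, at the relative groups for n≥1. Injectivity at n=1 is for the map to unions of classes. *)

theory Defs
  imports "HOL-Algebra.Free_Abelian_Groups"
begin

section \<open>Heaps\<close>

locale heap =
  fixes X :: "'a set" and t :: "'a \<Rightarrow> 'a \<Rightarrow> 'a \<Rightarrow> 'a"
  assumes nonempty: "X \<noteq> {}"
    and closed: "\<lbrakk>x \<in> X; y \<in> X; z \<in> X\<rbrakk> \<Longrightarrow> t x y z \<in> X"
    and para_assoc_middle:
      "\<lbrakk>x1 \<in> X; x2 \<in> X; x3 \<in> X; x4 \<in> X; x5 \<in> X\<rbrakk>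
        \<Longrightarrow> t (t x1 x2 x3) x4 x5 = t x1 (t x4 x3 x2) x5"
    and para_assoc_right:
      "\<lbrakk>x1 \<in> X; x2 \<in> X; x3 \<in> X; x4 \<in> X; x5 \<in> X\<rbrakk>
        \<Longrightarrow> t x1 (t x4 x3 x2) x5 = t x1 x2 (t x3 x4 x5)"
    and left_degenerate: "\<lbrakk>x \<in> X; y \<in> X\<rbrakk> \<Longrightarrow> t x x y = y"
    and right_degenerate: "\<lbrakk>x \<in> X; y \<in> X\<rbrakk> \<Longrightarrow> t x y y = x"

definition heap_group :: "'a set \<Rightarrow> ('a \<Rightarrow> 'a \<Rightarrow> 'a \<Rightarrow> 'a) \<Rightarrow> 'a \<Rightarrow> 'a monoid" where
  "heap_group X t e = \<lparr>carrier = X, monoid.mult = (\<lambda>x y. t x e y), one = e\<rparr>"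


section \<open>Homology of complexes of abelian groups\<close>

text \<open>
  A complex is given by groups \<open>C n\<close> and differentials \<open>d n\<close> from \<open>C n\<close> to \<open>C (n - 1)\<close>.
  For \<open>n = 0\<close> the target reads \<open>C 0\<close>; all complexes below have \<open>d 0 = 0\<close>.
\<close>

definition boundaries :: "(nat \<Rightarrow> 'c monoid) \<Rightarrow> (nat \<Rightarrow> 'c \<Rightarrow> 'c) \<Rightarrow> nat \<Rightarrow> 'c set" where
  "boundaries C d n = d (Suc n) ` carrier (C (Suc n))"

definition homology :: "(nat \<Rightarrow> 'c monoid) \<Rightarrow> (nat \<Rightarrow> 'c \<Rightarrow> 'c) \<Rightarrow> nat \<Rightarrow> 'c set monoid" where
  "homology C d n = (C n)\<lparr>carrier := kernel (C n) (C (n - 1)) (d n)\<rparr> Mod boundaries C d n"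

text \<open>
  The map on cosets induced by \<open>f\<close>, for a target quotient \<open>K Mod N\<close>.  When \<open>f\<close> respects the
  subgroups, the product \<open>N <#> f ` A\<close> is the coset of \<open>f a\<close> for any \<open>a \<in> A\<close>; when it
  does not, this is a union of several cosets.
\<close>

definition induced :: "'d monoid \<Rightarrow> 'd set \<Rightarrow> ('c \<Rightarrow> 'd) \<Rightarrow> 'c set \<Rightarrow> 'd set" where
  "induced K N f A = N <#>\<^bsub>K\<^esub> (f ` A)"

text \<open>
  Exactness at \<open>B\<close>.  The library's \<open>exact_seq\<close> requires all groups to have the same element
  type, which fails here since the relative group is a quotient of a quotient.
\<close>

definition exact_at ::
    "'a monoid \<Rightarrow> ('a \<Rightarrow> 'b) \<Rightarrow> 'b monoid \<Rightarrow> ('b \<Rightarrow> 'c) \<Rightarrow> 'c monoid \<Rightarrow> bool" where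
  "exact_at A f B g C \<longleftrightarrow> group_hom A B f \<and> group_hom B C g \<and> kernel B C g = f ` carrier A"


section \<open>Group homology with trivial integer coefficients\<close>

text \<open>Tuples are lists; the entry \<open>x\<^sub>j\<close> of a tuple \<open>xs\<close> is \<open>xs ! (j - 1)\<close>.\<close>

definition group_chains :: "'a monoid \<Rightarrow> nat \<Rightarrow> ('a list \<Rightarrow>\<^sub>0 int) monoid" where
  "group_chains G n = free_Abelian_group {xs. length xs = n \<and> set xs \<subseteq> carrier G}"

definition group_boundary_gen :: "'a monoid \<Rightarrow> nat \<Rightarrow> 'a list \<Rightarrow> 'a list \<Rightarrow>\<^sub>0 int" where
  "group_boundary_gen G n xs =
    (if n = 0 then 0 else
      - frag_of (drop 1 xs)
      + (\<Sum>i = 1..n - 1. frag_cmul ((-1) ^ (i + 1))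
          (frag_of (take (i - 1) xs @ [xs ! (i - 1) \<otimes>\<^bsub>G\<^esub> xs ! i] @ drop (i + 1) xs)))
      + frag_cmul ((-1) ^ (n + 1)) (frag_of (take (n - 1) xs)))"

definition group_boundary :: "'a monoid \<Rightarrow> nat \<Rightarrow> ('a list \<Rightarrow>\<^sub>0 int) \<Rightarrow> ('a list \<Rightarrow>\<^sub>0 int)" where
  "group_boundary G n = frag_extend (group_boundary_gen G n)"

definition group_homology :: "'a monoid \<Rightarrow> nat \<Rightarrow> ('a list \<Rightarrow>\<^sub>0 int) set monoid" where
  "group_homology G = homology (group_chains G) (group_boundary G)"


section \<open>Para-associative homology of type 0\<close>

text \<open>
  The complex starts in degree 1.  Degree 0 is the zero group; it has to be split off because
  \<open>2 * n - 1\<close> is \<open>0\<close> for \<open>n = 0\<close> on natural numbers.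
\<close>

definition heap_tuples :: "'a set \<Rightarrow> nat \<Rightarrow> 'a list set" where
  "heap_tuples X n = (if n = 0 then {} else {xs. length xs = 2 * n - 1 \<and> set xs \<subseteq> X})"

definition heap_chains :: "'a set \<Rightarrow> nat \<Rightarrow> ('a list \<Rightarrow>\<^sub>0 int) monoid" where
  "heap_chains X n = free_Abelian_group (heap_tuples X n)"

text \<open>In degree 2 there is an extra term \<open>(x\<^sub>2)\<close> that the general formula does not produce.\<close>

definition heap_boundary_gen ::
    "('a \<Rightarrow> 'a \<Rightarrow> 'a \<Rightarrow> 'a) \<Rightarrow> nat \<Rightarrow> 'a list \<Rightarrow> 'a list \<Rightarrow>\<^sub>0 int" where
  "heap_boundary_gen t n xs =
    (if n \<le> 1 then 0
     else if n = 2 then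
      frag_of [t (xs ! 0) (xs ! 1) (xs ! 2)]
      - frag_of [xs ! 0] + frag_of [xs ! 1] - frag_of [xs ! 2]
     else
      - frag_of (drop 2 xs)
      + (\<Sum>i = 1..n - 1. frag_cmul ((-1) ^ (i + 1))
          (frag_of (take (2 * i - 2) xs
            @ [t (xs ! (2 * i - 2)) (xs ! (2 * i - 1)) (xs ! (2 * i))]
            @ drop (2 * i + 1) xs)))
      + frag_cmul ((-1) ^ (n + 1)) (frag_of (take (2 * n - 3) xs)))"

definition heap_boundary ::
    "('a \<Rightarrow> 'a \<Rightarrow> 'a \<Rightarrow> 'a) \<Rightarrow> nat \<Rightarrow> ('a list \<Rightarrow>\<^sub>0 int) \<Rightarrow> ('a list \<Rightarrow>\<^sub>0 int)" where
  "heap_boundary t n = frag_extend (heap_boundary_gen t n)"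

definition heap_homology ::
    "'a set \<Rightarrow> ('a \<Rightarrow> 'a \<Rightarrow> 'a \<Rightarrow> 'a) \<Rightarrow> nat \<Rightarrow> ('a list \<Rightarrow>\<^sub>0 int) set monoid" where
  "heap_homology X t = homology (heap_chains X) (heap_boundary t)"


section \<open>The subcomplex attached to a base point, and relative homology\<close>

definition hat_chains :: "'a set \<Rightarrow> 'a \<Rightarrow> nat \<Rightarrow> ('a list \<Rightarrow>\<^sub>0 int) set" where
  "hat_chains X e n =
    carrier (free_Abelian_group {xs \<in> heap_tuples X n. \<forall>i\<in>{1..n - 1}. xs ! (2 * i - 1) = e})"

definition rel_chains :: "'a set \<Rightarrow> 'a \<Rightarrow> nat \<Rightarrow> ('a list \<Rightarrow>\<^sub>0 int) set monoid" where
  "rel_chains X e n = heap_chains X n Mod hat_chains X e n"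

definition rel_boundary ::
    "'a set \<Rightarrow> ('a \<Rightarrow> 'a \<Rightarrow> 'a \<Rightarrow> 'a) \<Rightarrow> 'a \<Rightarrow> nat
      \<Rightarrow> ('a list \<Rightarrow>\<^sub>0 int) set \<Rightarrow> ('a list \<Rightarrow>\<^sub>0 int) set" where
  "rel_boundary X t e n = induced (heap_chains X (n - 1)) (hat_chains X e (n - 1)) (heap_boundary t n)"

definition rel_homology ::
    "'a set \<Rightarrow> ('a \<Rightarrow> 'a \<Rightarrow> 'a \<Rightarrow> 'a) \<Rightarrow> 'a \<Rightarrow> nat \<Rightarrow> ('a list \<Rightarrow>\<^sub>0 int) set set monoid" where
  "rel_homology X t e = homology (rel_chains X e) (rel_boundary X t e)"


section \<open>The maps of the long exact sequence\<close>

fun intersperse :: "'a \<Rightarrow> 'a list \<Rightarrow> 'a list" where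
  "intersperse e [] = []"
| "intersperse e [x] = [x]"
| "intersperse e (x # y # ys) = x # e # intersperse e (y # ys)"

definition Psi :: "'a \<Rightarrow> ('a list \<Rightarrow>\<^sub>0 int) \<Rightarrow> ('a list \<Rightarrow>\<^sub>0 int)" where
  "Psi e = frag_extend (\<lambda>xs. frag_of (intersperse e xs))"

text \<open>
  \<open>Psi\<close> commutes with the differentials from degree 3 on, but
  \<open>\<partial> (Psi (x, y)) = Psi (\<partial> (x, y)) + (e)\<close>.  It still maps 2-cycles to 2-cycles, since those have
  coefficient sum 0, so \<open>Psi_bar n\<close> is a map of homology groups for \<open>n \<ge> 2\<close>.  It does not map
  1-boundaries to 1-boundaries: \<open>Psi_bar 1\<close> sends a class to the union of the
  classes of the images of its representatives.
\<close>

definition Psi_bar ::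
    "'a set \<Rightarrow> ('a \<Rightarrow> 'a \<Rightarrow> 'a \<Rightarrow> 'a) \<Rightarrow> 'a \<Rightarrow> nat
      \<Rightarrow> ('a list \<Rightarrow>\<^sub>0 int) set \<Rightarrow> ('a list \<Rightarrow>\<^sub>0 int) set" where
  "Psi_bar X t e n =
    induced (heap_chains X n) (boundaries (heap_chains X) (heap_boundary t) n) (Psi e)"

definition rel_proj ::
    "'a set \<Rightarrow> ('a \<Rightarrow> 'a \<Rightarrow> 'a \<Rightarrow> 'a) \<Rightarrow> 'a \<Rightarrow> nat
      \<Rightarrow> ('a list \<Rightarrow>\<^sub>0 int) set \<Rightarrow> ('a list \<Rightarrow>\<^sub>0 int) set set" where
  "rel_proj X t e n =
    induced (rel_chains X e n) (boundaries (rel_chains X e) (rel_boundary X t e) n)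
      (\<lambda>c. hat_chains X e n #>\<^bsub>heap_chains X n\<^esub> c)"

text \<open>
  The connecting map: lift a relative class to a chain \<open>c \<in> \<Union>\<zeta>\<close>, apply the boundary, and
  pull the result back along \<open>Psi\<close> to a group chain.
\<close>

definition connecting ::
    "'a set \<Rightarrow> ('a \<Rightarrow> 'a \<Rightarrow> 'a \<Rightarrow> 'a) \<Rightarrow> 'a \<Rightarrow> nat
      \<Rightarrow> ('a list \<Rightarrow>\<^sub>0 int) set set \<Rightarrow> ('a list \<Rightarrow>\<^sub>0 int) set" where
  "connecting X t e n \<zeta> =
    (let G = heap_group X t e in
      boundaries (group_chains G) (group_boundary G) (n - 1) <#>\<^bsub>group_chains G (n - 1)\<^esub>
        {w \<in> carrier (group_chains G (n - 1)). Psi e w \<in> heap_boundary t n ` \<Union>\<zeta>})"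

end

theory Submission
  imports Defs
begin

text \<open>
  The map \<^term>\<open>Psi e\<close> identifies the bar complex of the group with the subcomplex of tuples whose
  even entries are the base point, because \<open>[x, e, y] = x y\<close>.  The long exact sequence is that of
  the inclusion of this subcomplex.  From degree 3 on \<open>Psi\<close> commutes with the differentials.  In degree 2
  the heap differential has an extra term, so \<open>\<partial> (Psi v) = Psi (\<partial> v) + \<epsilon>(v) (e)\<close> with \<open>\<epsilon>(v)\<close> the sum of
  the coefficients of \<open>v\<close>.  Three facts absorb this error: \<open>\<epsilon>(\<partial> v) = - \<epsilon>(v)\<close> for a group 2-chain,
  \<open>\<epsilon>(\<partial> c) = 0\<close> for a heap chain of degree 2 or 3, and \<open>(e) = - \<partial> (e, e)\<close> in the bar complex.  They make
  \<open>Psi\<close> preserve 2-cycles and make the connecting map well defined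
  (\<open>Psi_cycle\<close>, \<open>Psi_boundary_mod\<close>, \<open>Psi_preimage_of_boundary\<close>, \<open>boundary_lifts_to_hat\<close>).

  Injectivity comes from a retraction on chains.  Write \<open>x / y\<close> for \<open>[x, y, e]\<close>, which is \<open>x y\<^sup>-\<^sup>1\<close>, and let
  \<open>q\<^sub>u (x\<^sub>1, y\<^sub>1, \<dots>, x\<^sub>n) = (x\<^sub>1 / y\<^sub>1, \<dots>, x\<^sub>n\<^sub>-\<^sub>1 / y\<^sub>n\<^sub>-\<^sub>1, u)\<close>.  The map \<open>q\<^sub>u\<close> with \<open>u = x\<^sub>n\<close> is compatible with all
  faces except the one that forgets \<open>y\<^sub>n\<^sub>-\<^sub>1\<close> and \<open>x\<^sub>n\<close>: there the word keeps \<open>x\<^sub>n\<^sub>-\<^sub>1 / y\<^sub>n\<^sub>-\<^sub>1\<close>, whereas the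
  tuple keeps \<open>x\<^sub>n\<^sub>-\<^sub>1\<close>.  The correction \<open>- q\<^sub>u\<close> with \<open>u = y\<^sub>n\<^sub>-\<^sub>1\<close> supplies the right term, since multiplying
  its last two letters gives \<open>(x\<^sub>n\<^sub>-\<^sub>1 / y\<^sub>n\<^sub>-\<^sub>1) y\<^sub>n\<^sub>-\<^sub>1 = x\<^sub>n\<^sub>-\<^sub>1\<close>, and \<open>+ q\<^sub>e\<close> removes the wrong one.  The resulting
  alternating sum \<open>Phi\<close> commutes with the differentials from degree 3 on (\<open>Phi_boundary\<close>), and on the
  image of \<open>Psi\<close> the two corrections cancel each other, so \<open>Phi \<circ> Psi\<close> is the identity
  from degree 2 on (\<open>Phi_Psi\<close>).  Hence a group cycle whose image bounds is itself a boundary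
  (\<open>Psi_reflects_boundaries\<close>).
\<close>

section \<open>Homology of complexes of abelian groups\<close>

text \<open>
  When \<open>f\<close> respects the subgroups, the product defining \<^const>\<open>induced\<close> is a single coset.
\<close>

lemma induced_coset:
  assumes "comm_group A" "comm_group K" "subgroup N A" "subgroup M K"
    and f: "f \<in> hom A K" "f ` N \<subseteq> M" and a: "a \<in> carrier A"
  shows "induced K M f (N #>\<^bsub>A\<^esub> a) = M #>\<^bsub>K\<^esub> f a"
proof -
  interpret A: comm_group A by fact
  interpret K: comm_group K by fact
  interpret N: subgroup N A by fact
  interpret M: subgroup M K by fact
  have fa: "f a \<in> carrier K" using f a by (auto simp: hom_def)
  have f1: "f \<one>\<^bsub>A\<^esub> = \<one>\<^bsub>K\<^esub>"
    using f(1) A.is_group K.is_group by (rule hom_one)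
  have fN: "f (y \<otimes>\<^bsub>A\<^esub> a) = f y \<otimes>\<^bsub>K\<^esub> f a" if "y \<in> N" for y
    using that f(1) a by (auto simp: hom_def)
  show ?thesis
  proof (intro equalityI subsetI)
    fix z assume "z \<in> induced K M f (N #>\<^bsub>A\<^esub> a)"
    then obtain m y where m: "m \<in> M" "y \<in> N" and z: "z = m \<otimes>\<^bsub>K\<^esub> f (y \<otimes>\<^bsub>A\<^esub> a)"
      by (auto simp: induced_def set_mult_def r_coset_def)
    have "z = (m \<otimes>\<^bsub>K\<^esub> f y) \<otimes>\<^bsub>K\<^esub> f a"
      using z m fN f(2) fa by (auto intro!: K.m_assoc[symmetric])
    moreover have "m \<otimes>\<^bsub>K\<^esub> f y \<in> M" using m f(2) by auto
    ultimately show "z \<in> M #>\<^bsub>K\<^esub> f a" by (auto simp: r_coset_def)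
  next
    fix z assume "z \<in> M #>\<^bsub>K\<^esub> f a"
    then obtain m where m: "m \<in> M" and z: "z = m \<otimes>\<^bsub>K\<^esub> f a" by (auto simp: r_coset_def)
    have "f a = f (\<one>\<^bsub>A\<^esub> \<otimes>\<^bsub>A\<^esub> a)" using a by simp
    then show "z \<in> induced K M f (N #>\<^bsub>A\<^esub> a)"
      using m z N.one_closed by (force simp: induced_def set_mult_def r_coset_def)
  qed
qed

locale abelian_complex =
  fixes C :: "nat \<Rightarrow> 'c monoid" and d :: "nat \<Rightarrow> 'c \<Rightarrow> 'c"
  assumes comm: "comm_group (C n)"
    and hom: "d n \<in> hom (C n) (C (n - 1))"
    and square_zero: "c \<in> carrier (C (Suc n)) \<Longrightarrow> d n (d (Suc n) c) = \<one>\<^bsub>C (n - 1)\<^esub>"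
begin

abbreviation cycles :: "nat \<Rightarrow> 'c set" where
  "cycles n \<equiv> kernel (C n) (C (n - 1)) (d n)"

abbreviation hclass :: "nat \<Rightarrow> 'c \<Rightarrow> 'c set" where
  "hclass n c \<equiv> boundaries C d n #>\<^bsub>C n\<^esub> c"

lemma group: "Group.group (C n)"
  using comm by (rule comm_group.axioms(2))

lemma group_hom_d: "group_hom (C n) (C (n - 1)) (d n)"
  using hom[of n] by (simp add: group_hom_def group_hom_axioms_def group)

lemma subgroup_cycles: "subgroup (cycles n) (C n)"
  using group_hom_d by (rule group_hom.subgroup_kernel)

lemma subgroup_boundaries: "subgroup (boundaries C d n) (C n)"
  using group_hom.img_is_subgroup[OF group_hom_d[of "Suc n"]] by (simp add: boundaries_def)

lemma boundaries_subset_cycles: "boundaries C d n \<subseteq> cycles n"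
  using hom[of "Suc n"] by (auto simp: boundaries_def kernel_def hom_def square_zero)

lemma comm_group_cycles: "comm_group ((C n)\<lparr>carrier := cycles n\<rparr>)"
proof -
  interpret comm_group "C n" by (rule comm)
  interpret subgroup "cycles n" "C n" by (rule subgroup_cycles)
  show ?thesis
    by (rule group.group_comm_groupI[OF subgroup_is_group]) (auto simp: m_comm)
qed

lemma subgroup_boundaries_cycles: "subgroup (boundaries C d n) ((C n)\<lparr>carrier := cycles n\<rparr>)"
  by (rule group.subgroup_incl[OF group subgroup_boundaries subgroup_cycles boundaries_subset_cycles])

lemma comm_group_homology: "comm_group (homology C d n)"
  unfolding homology_def
  by (rule comm_group.abelian_FactGroup[OF comm_group_cycles subgroup_boundaries_cycles])

lemma group_homology: "Group.group (homology C d n)"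
  using comm_group_homology by (rule comm_group.axioms(2))

lemma carrier_homology: "carrier (homology C d n) = hclass n ` cycles n"
  by (simp add: homology_def carrier_FactGroup r_coset_def)

lemma one_homology: "\<one>\<^bsub>homology C d n\<^esub> = boundaries C d n"
  by (simp add: homology_def)

lemma mult_homology:
  assumes "a \<in> carrier (C n)" "b \<in> carrier (C n)"
  shows "hclass n a \<otimes>\<^bsub>homology C d n\<^esub> hclass n b = hclass n (a \<otimes>\<^bsub>C n\<^esub> b)"
proof -
  have "boundaries C d n \<lhd> C n"
    using comm_group.subgroup_imp_normal[OF comm subgroup_boundaries] .
  then show ?thesis
    using assms by (simp add: homology_def normal.rcos_sum)
qed

lemma hclass_eq_one_iff:
  assumes "c \<in> carrier (C n)"
  shows "hclass n c = boundaries C d n \<longleftrightarrow> c \<in> boundaries C d n"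
  using assms group subgroup_boundaries
  by (meson group.coset_join1 group.coset_join2 subgroup.subset)

end

text \<open>
  The hypotheses concern cycles and boundaries of the single degree \<open>n\<close>, because \<^const>\<open>Psi\<close> preserves
  these in degree 2 without commuting with the differential there.
\<close>

lemma hom_homology:
  assumes C: "abelian_complex C d" and D: "abelian_complex D d'"
    and f: "f \<in> hom (C n) (D n)"
    and cyc: "f ` kernel (C n) (C (n - 1)) (d n) \<subseteq> kernel (D n) (D (n - 1)) (d' n)"
    and bnd: "f ` boundaries C d n \<subseteq> boundaries D d' n"
  shows "group_hom (homology C d n) (homology D d' n) (induced (D n) (boundaries D d' n) f)"
proof -
  interpret C: abelian_complex C d by fact
  interpret D: abelian_complex D d' by fact
  note ind = induced_coset[OF C.comm D.comm C.subgroup_boundaries D.subgroup_boundaries f bnd]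
  have sub: "c \<in> carrier (C n)" "f c \<in> carrier (D n)" if "c \<in> C.cycles n" for c
    using that f by (auto simp: kernel_def hom_def)
  have "induced (D n) (boundaries D d' n) f \<in> hom (homology C d n) (homology D d' n)"
  proof (rule homI)
    fix A assume "A \<in> carrier (homology C d n)"
    then show "induced (D n) (boundaries D d' n) f A \<in> carrier (homology D d' n)"
      using cyc by (auto simp: C.carrier_homology D.carrier_homology ind sub)
  next
    fix A B assume "A \<in> carrier (homology C d n)" "B \<in> carrier (homology C d n)"
    then obtain a b where ab: "a \<in> C.cycles n" "A = C.hclass n a" "b \<in> C.cycles n" "B = C.hclass n b"
      by (auto simp: C.carrier_homology)
    have "a \<otimes>\<^bsub>C n\<^esub> b \<in> carrier (C n)"
      using ab sub C.group by (meson group.is_monoid monoid.m_closed)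
    moreover have "f (a \<otimes>\<^bsub>C n\<^esub> b) = f a \<otimes>\<^bsub>D n\<^esub> f b"
      using f ab sub by (auto simp: hom_def)
    ultimately show "induced (D n) (boundaries D d' n) f (A \<otimes>\<^bsub>homology C d n\<^esub> B) =
        induced (D n) (boundaries D d' n) f A \<otimes>\<^bsub>homology D d' n\<^esub> induced (D n) (boundaries D d' n) f B"
      using ab by (simp add: C.mult_homology D.mult_homology ind sub)
  qed
  then show ?thesis
    by (simp add: group_hom_def group_hom_axioms_def C.group_homology D.group_homology)
qed

section \<open>Linear extension and alternating sums in free abelian groups\<close>

lemma frag_extend_frag_extend:
  "frag_extend f (frag_extend g c) = frag_extend (\<lambda>x. frag_extend f (g x)) c"
  using subset_UNIV by (induction c rule: frag_induction) (auto simp: frag_extend_diff)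

lemma frag_extend_gen_add:
  "frag_extend (\<lambda>x. f x + g x) c = frag_extend f c + frag_extend g c"
  using subset_UNIV by (induction c rule: frag_induction) (auto simp: frag_extend_diff)

lemma frag_extend_gen_diff:
  "frag_extend (\<lambda>x. f x - g x) c = frag_extend f c - frag_extend g c"
  using subset_UNIV by (induction c rule: frag_induction) (auto simp: frag_extend_diff)

lemma frag_cmul_diff: "frag_cmul k (a - b) = frag_cmul k a - frag_cmul k b"
  by (simp add: poly_mapping_eqI lookup_minus right_diff_distrib)

lemma frag_extend_gen_minus:
  "frag_extend (\<lambda>x. - f x) c = - frag_extend f c"
  using subset_UNIV by (induction c rule: frag_induction) (auto simp: frag_extend_diff)

text \<open>
  The simplicial identities cancel the double sum in pairs: the term at \<open>(j, i)\<close> with \<open>i < j\<close> equals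
  the term at \<open>(i, j - 1)\<close> and carries the opposite sign.
\<close>

lemma alternating_double_sum:
  fixes f :: "nat \<Rightarrow> nat \<Rightarrow> 'a \<Rightarrow>\<^sub>0 int"
  assumes "\<And>i j. i < j \<Longrightarrow> j \<le> Suc n \<Longrightarrow> f i j = f (j - 1) i"
  shows "(\<Sum>j\<le>Suc n. frag_cmul ((-1) ^ (j + 1)) (\<Sum>i\<le>n. frag_cmul ((-1) ^ (i + 1)) (f i j))) = 0"
proof -
  define g where "g = (\<lambda>(j, i). frag_cmul ((-1) ^ (j + i)) (f i j))"
  define P where "P = {(j, i). i < j \<and> j \<le> Suc n}"
  define Q where "Q = {(j, i). j \<le> i \<and> i \<le> n}"
  have sign: "(-1 :: int) ^ (j + 1) * (-1) ^ (i + 1) = (-1) ^ (j + i)" for i j :: nat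
    by (simp add: power_add)
  have split: "{..Suc n} \<times> {..n} = P \<union> Q" and disj: "P \<inter> Q = {}"
    unfolding P_def Q_def by auto
  have fin: "finite P" "finite Q"
    using split by (metis finite_Un finite_SigmaI finite_atMost)+
  have "sum g P = (\<Sum>p\<in>Q. - g p)"
  proof (rule sum.reindex_bij_witness[of _ "\<lambda>(j, i). (Suc i, j)" "\<lambda>(j, i). (i, j - 1)"])
    fix p assume "p \<in> P"
    then obtain i j where p: "p = (Suc j, i)" "i < Suc j" "Suc j \<le> Suc n"
      unfolding P_def by (cases p; cases "fst p") auto
    have "g (i, j) = frag_cmul ((-1) ^ (j + i)) (f j i)"
      by (simp only: g_def prod.case add.commute)
    moreover have "g p = frag_cmul (- ((-1) ^ (j + i))) (f j i)"
      using assms[OF p(2,3)] by (simp add: g_def p(1))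
    ultimately show "- g (case p of (j, i) \<Rightarrow> (i, j - 1)) = g p"
      by (simp add: p(1))
  qed (auto simp: P_def Q_def)
  then have "sum g (P \<union> Q) = 0"
    by (simp add: sum.union_disjoint[OF fin disj] sum_negf)
  then show ?thesis
    by (simp only: frag_cmul_sum frag_cmul_cmul sign sum.cartesian_product g_def split)
qed

section \<open>Faces of tuples and of words\<close>

text \<open>
  The recursion strips two entries at a time, so identities between merges can be proved by
  induction on the position instead of by index arithmetic.
\<close>

fun heap_merge :: "('a \<Rightarrow> 'a \<Rightarrow> 'a \<Rightarrow> 'a) \<Rightarrow> nat \<Rightarrow> 'a list \<Rightarrow> 'a list" where
  "heap_merge t 0 (x # y # z # zs) = t x y z # zs"
| "heap_merge t (Suc i) (x # y # zs) = x # y # heap_merge t i zs"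
| "heap_merge t i xs = xs"

fun group_merge :: "('a \<Rightarrow> 'a \<Rightarrow> 'a) \<Rightarrow> nat \<Rightarrow> 'a list \<Rightarrow> 'a list" where
  "group_merge m 0 (x # y # ys) = m x y # ys"
| "group_merge m (Suc i) (x # xs) = x # group_merge m i xs"
| "group_merge m i xs = xs"

lemma heap_merge_conv:
  assumes "2 * i + 3 \<le> length xs"
  shows "heap_merge t i xs =
    take (2 * i) xs @ [t (xs ! (2 * i)) (xs ! (2 * i + 1)) (xs ! (2 * i + 2))] @ drop (2 * i + 3) xs"
  using assms by (induction t i xs rule: heap_merge.induct) (auto simp: numeral_3_eq_3)

lemma group_merge_conv:
  assumes "i + 2 \<le> length xs"
  shows "group_merge m i xs = take i xs @ [m (xs ! i) (xs ! Suc i)] @ drop (i + 2) xs"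
  using assms by (induction m i xs rule: group_merge.induct) auto

lemma length_heap_merge: "2 * i + 3 \<le> length xs \<Longrightarrow> length (heap_merge t i xs) = length xs - 2"
  by (simp add: heap_merge_conv)

lemma length_group_merge: "i + 2 \<le> length xs \<Longrightarrow> length (group_merge m i xs) = length xs - 1"
  by (simp add: group_merge_conv)

lemma drop_heap_merge_0: "3 \<le> length xs \<Longrightarrow> drop 2 (heap_merge t 0 xs) = drop 2 (drop 2 xs)"
  by (auto simp: numeral_eq_Suc Suc_le_length_iff)

lemma drop_heap_merge_Suc: "2 \<le> length xs \<Longrightarrow> drop 2 (heap_merge t (Suc i) xs) = heap_merge t i (drop 2 xs)"
  by (auto simp: numeral_eq_Suc Suc_le_length_iff)

lemma take_heap_merge_small:
  "k \<le> 2 * i \<Longrightarrow> 2 * i + 3 \<le> length xs \<Longrightarrow> take k (heap_merge t i xs) = take k xs"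
  by (simp add: heap_merge_conv)

lemma heap_merge_take:
  assumes "2 * i + 3 \<le> k" "k \<le> length xs"
  shows "heap_merge t i (take k xs) = take (k - 2) (heap_merge t i xs)"
proof -
  obtain l where k: "k = 2 * i + 3 + l" using assms(1) le_Suc_ex by blast
  have "heap_merge t i (take k xs) =
      take (2 * i) xs @ [t (xs ! (2 * i)) (xs ! (2 * i + 1)) (xs ! (2 * i + 2))] @ take l (drop (2 * i + 3) xs)"
    using assms k by (subst heap_merge_conv) (simp_all add: drop_take)
  moreover have "k - 2 = Suc (2 * i + l)" using k by simp
  ultimately show ?thesis
    using assms k by (simp add: heap_merge_conv)
qed

lemma last_heap_merge: "2 * i + 5 \<le> length xs \<Longrightarrow> last (heap_merge t i xs) = last xs"
  by (simp add: heap_merge_conv)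

lemma last_butlast_heap_merge:
  "2 * i + 5 \<le> length xs \<Longrightarrow> last (butlast (heap_merge t i xs)) = last (butlast xs)"
  by (auto simp: heap_merge_conv butlast_append simp flip: drop_butlast)

lemma (in heap) set_heap_merge:
  "set xs \<subseteq> X \<Longrightarrow> set (heap_merge t i xs) \<subseteq> X"
proof (induction i arbitrary: xs)
  case 0
  show ?case using 0 closed by (cases "(t, 0::nat, xs)" rule: heap_merge.cases) auto
next
  case (Suc i)
  then show ?case by (cases "(t, Suc i, xs)" rule: heap_merge.cases) auto
qed

text \<open>
  For adjacent positions this is para-associativity; for distant ones the two merges act on disjoint
  parts of the tuple.
\<close>

lemma (in heap) heap_merge_heap_merge:
  assumes "set xs \<subseteq> X" "i \<le> j" "2 * j + 5 \<le> length xs"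
  shows "heap_merge t i (heap_merge t (Suc j) xs) = heap_merge t j (heap_merge t i xs)"
  using assms
proof (induction i arbitrary: j xs)
  case 0
  show ?case
  proof (cases j)
    case 0
    with \<open>2 * j + 5 \<le> length xs\<close> obtain x y z u v zs where "xs = x # y # z # u # v # zs"
      by (auto simp: numeral_eq_Suc Suc_le_length_iff)
    then show ?thesis using 0 \<open>set xs \<subseteq> X\<close> para_assoc_middle para_assoc_right by simp
  next
    case (Suc k)
    with \<open>2 * j + 5 \<le> length xs\<close> obtain x y z u zs where "xs = x # y # z # u # zs"
      by (auto simp: numeral_eq_Suc Suc_le_length_iff)
    then show ?thesis using Suc by simp
  qed
next
  case (Suc i)
  then obtain k where k: "j = Suc k" by (cases j) auto
  with Suc.prems obtain x y zs where "xs = x # y # zs"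
    by (auto simp: numeral_eq_Suc Suc_le_length_iff)
  then show ?case using Suc k by simp
qed

text \<open>
  Numbered so that the faces \<open>0, \<dots>, n\<close> satisfy the simplicial identities; the outer two
  faces forget two entries, the inner ones multiply three neighbours.
\<close>

definition heap_face :: "('a \<Rightarrow> 'a \<Rightarrow> 'a \<Rightarrow> 'a) \<Rightarrow> nat \<Rightarrow> nat \<Rightarrow> 'a list \<Rightarrow> 'a list" where
  "heap_face t n i xs =
    (if i = 0 then drop 2 xs else if i = n then take (2 * n - 3) xs else heap_merge t (i - 1) xs)"

definition group_face :: "('a \<Rightarrow> 'a \<Rightarrow> 'a) \<Rightarrow> nat \<Rightarrow> nat \<Rightarrow> 'a list \<Rightarrow> 'a list" where
  "group_face m n i xs =
    (if i = 0 then drop 1 xs else if i = n then take (n - 1) xs else group_merge m (i - 1) xs)"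

lemma sum_atMost_ends:
  fixes f :: "nat \<Rightarrow> 'b :: comm_monoid_add"
  assumes "1 \<le> n"
  shows "sum f {..n} = f 0 + sum f {1..n - 1} + f n"
proof -
  have "{..n} = insert 0 (insert n {1..n - 1})" using assms by auto
  then show ?thesis using assms by (simp add: add_ac)
qed

lemma heap_boundary_gen_faces:
  assumes "3 \<le> n" "length xs = 2 * n - 1"
  shows "heap_boundary_gen t n xs = (\<Sum>i\<le>n. frag_cmul ((-1) ^ (i + 1)) (frag_of (heap_face t n i xs)))"
proof -
  have "take (2 * i - 2) xs @ [t (xs ! (2 * i - 2)) (xs ! (2 * i - 1)) (xs ! (2 * i))] @ drop (2 * i + 1) xs
      = heap_face t n i xs" if i: "i \<in> {1..n - 1}" for i
  proof -
    obtain k where k: "i = Suc k" using i by (cases i) auto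
    then have "2 * k + 3 \<le> length xs" "i \<noteq> n" using i assms by auto
    then show ?thesis using k by (simp add: heap_face_def heap_merge_conv numeral_3_eq_3)
  qed
  then have "heap_boundary_gen t n xs = - frag_of (drop 2 xs)
      + (\<Sum>i = 1..n - 1. frag_cmul ((-1) ^ (i + 1)) (frag_of (heap_face t n i xs)))
      + frag_cmul ((-1) ^ (n + 1)) (frag_of (take (2 * n - 3) xs))"
    using assms(1) by (auto simp: heap_boundary_gen_def intro!: sum.cong)
  then show ?thesis
    using assms(1) by (subst sum_atMost_ends) (simp_all add: heap_face_def)
qed

lemma group_boundary_gen_faces:
  assumes "1 \<le> n" "length xs = n"
  shows "group_boundary_gen G n xs =
    (\<Sum>i\<le>n. frag_cmul ((-1) ^ (i + 1)) (frag_of (group_face (monoid.mult G) n i xs)))"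
proof -
  have "take (i - 1) xs @ [xs ! (i - 1) \<otimes>\<^bsub>G\<^esub> xs ! i] @ drop (i + 1) xs
      = group_face (monoid.mult G) n i xs" if i: "i \<in> {1..n - 1}" for i
  proof -
    obtain k where k: "i = Suc k" using i by (cases i) auto
    then have "k + 2 \<le> length xs" "i \<noteq> n" using i assms by auto
    then show ?thesis using k by (simp add: group_face_def group_merge_conv)
  qed
  then have "group_boundary_gen G n xs = - frag_of (drop 1 xs)
      + (\<Sum>i = 1..n - 1. frag_cmul ((-1) ^ (i + 1)) (frag_of (group_face (monoid.mult G) n i xs)))
      + frag_cmul ((-1) ^ (n + 1)) (frag_of (take (n - 1) xs))"
    using assms(1) by (auto simp: group_boundary_gen_def intro!: sum.cong)
  then show ?thesis
    using assms(1) by (subst sum_atMost_ends) (simp_all add: group_face_def)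
qed

lemma length_heap_face:
  assumes "2 \<le> n" "i \<le> n" "length xs = 2 * n - 1"
  shows "length (heap_face t n i xs) = 2 * (n - 1) - 1"
  using assms by (auto simp: heap_face_def length_heap_merge)

lemma (in heap) heap_face_closed:
  assumes "set xs \<subseteq> X"
  shows "set (heap_face t n i xs) \<subseteq> X"
  using assms set_heap_merge[of xs] by (auto simp: heap_face_def dest!: in_set_takeD in_set_dropD)

text \<open>
  These are the simplicial identities behind \<open>\<partial> \<circ> \<partial> = 0\<close>.
\<close>

lemma (in heap) heap_face_heap_face:
  assumes "2 \<le> n" "i < j" "j \<le> Suc n" "length xs = 2 * n + 1" "set xs \<subseteq> X"
  shows "heap_face t n i (heap_face t (Suc n) j xs) = heap_face t n (j - 1) (heap_face t (Suc n) i xs)"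
proof (cases i)
  case 0
  consider "j = Suc n" | "j = 1" | k where "j = Suc (Suc k)" "j \<le> n"
    using assms(2,3) 0 by (metis One_nat_def le_SucE not0_implies_Suc not_less_zero)
  then show ?thesis
  proof cases
    case 1 
    have "2 * n - 3 = 2 * n - 1 - 2" by simp
    then show ?thesis using assms 0 1 by (simp add: heap_face_def drop_take)
  next
    case 2 then show ?thesis using assms 0 by (simp add: heap_face_def drop_heap_merge_0)
  next
    case 3 then show ?thesis using assms 0 by (simp add: heap_face_def drop_heap_merge_Suc)
  qed
next
  case (Suc k)
  consider "j = Suc n" "i = n" | "j = Suc n" "i < n" | "j \<le> n" using assms by linarith
  then show ?thesis
  proof cases
    case 1
    have "min (2 * n - 3) (2 * n - 1) = 2 * n - 3" by simp
    then show ?thesis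
      unfolding 1 using assms(1,4) by (simp add: heap_face_def take_heap_merge_small)
  next
    case 2
    have "2 * n - 3 = 2 * n - 1 - 2" by simp
    then show ?thesis unfolding 2(1) Suc using assms(1,4) 2(2) Suc by (simp add: heap_face_def heap_merge_take)
  next
    case 3
    then obtain l where l: "j = Suc (Suc l)" using assms(2) Suc by (cases j; cases "j - 1") auto
    have "heap_merge t k (heap_merge t (Suc l) xs) = heap_merge t l (heap_merge t k xs)"
      using assms 3 l Suc by (intro heap_merge_heap_merge) auto
    then show ?thesis using assms 3 l Suc by (simp add: heap_face_def)
  qed
qed

lemma keys_frag_extend_subset:
  assumes "Poly_Mapping.keys c \<subseteq> S" "\<And>x. x \<in> S \<Longrightarrow> Poly_Mapping.keys (f x) \<subseteq> T"
  shows "Poly_Mapping.keys (frag_extend f c) \<subseteq> T"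
  using keys_frag_extend[of f c] assms by blast

lemma keys_face_sum:
  assumes "\<And>i. i \<le> n \<Longrightarrow> F i \<in> T"
  shows "Poly_Mapping.keys (\<Sum>i\<le>n. frag_cmul (a i) (frag_of (F i))) \<subseteq> T"
proof -
  have "Poly_Mapping.keys (frag_cmul (a i) (frag_of (F i))) \<subseteq> T" if "i \<le> n" for i
    using keys_cmul[of "a i" "frag_of (F i)"] assms[OF that] by auto
  then show ?thesis
    using keys_sum[of "\<lambda>i. frag_cmul (a i) (frag_of (F i))" "{..n}"] by blast
qed

lemma keys_add_diff_subset:
  "Poly_Mapping.keys a \<subseteq> T \<Longrightarrow> Poly_Mapping.keys b \<subseteq> T \<Longrightarrow> Poly_Mapping.keys (a + b) \<subseteq> T"
  "Poly_Mapping.keys a \<subseteq> T \<Longrightarrow> Poly_Mapping.keys b \<subseteq> T \<Longrightarrow> Poly_Mapping.keys (a - b) \<subseteq> T"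
  using keys_add[of a b] keys_diff[of a b] by blast+

section \<open>The heap complex\<close>

lemma heap_boundary_gen_2:
  "heap_boundary_gen t 2 [x, y, z] = frag_of [t x y z] - frag_of [x] + frag_of [y] - frag_of [z]"
  by (simp add: heap_boundary_gen_def)

lemma heap_boundary_gen_3:
  "heap_boundary_gen t 3 [a, b, c, d, f] =
    - frag_of [c, d, f] + frag_of [t a b c, d, f] - frag_of [a, b, t c d f] + frag_of [a, b, c]"
  by (simp add: heap_boundary_gen_def eval_nat_numeral)

lemma group_boundary_gen_2:
  "group_boundary_gen G 2 [x, y] = - frag_of [y] + frag_of [x \<otimes>\<^bsub>G\<^esub> y] - frag_of [x]"
  by (simp add: group_boundary_gen_def eval_nat_numeral)

lemma heap_boundary_le_1: "n \<le> 1 \<Longrightarrow> heap_boundary t n c = 0"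
  unfolding heap_boundary_def by (rule frag_extend_eq_0) (simp add: heap_boundary_gen_def)

lemma heap_tuples_2E:
  assumes "xs \<in> heap_tuples X 2"
  obtains x y z where "xs = [x, y, z]" "x \<in> X" "y \<in> X" "z \<in> X"
  using assms by (auto simp: heap_tuples_def numeral_eq_Suc length_Suc_conv)

lemma heap_tuples_3E:
  assumes "xs \<in> heap_tuples X 3"
  obtains a b c d f where "xs = [a, b, c, d, f]" "a \<in> X" "b \<in> X" "c \<in> X" "d \<in> X" "f \<in> X"
  using assms by (auto simp: heap_tuples_def numeral_eq_Suc length_Suc_conv)

context heap
begin

lemma heap_face_in_tuples:
  assumes "2 \<le> n" "i \<le> n" "xs \<in> heap_tuples X n"
  shows "heap_face t n i xs \<in> heap_tuples X (n - 1)"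
  using assms length_heap_face[of n i xs] heap_face_closed[of xs n i]
  by (auto simp: heap_tuples_def)

lemma keys_heap_boundary_gen:
  assumes "xs \<in> heap_tuples X n"
  shows "Poly_Mapping.keys (heap_boundary_gen t n xs) \<subseteq> heap_tuples X (n - 1)"
proof -
  consider "n \<le> 1" | "n = 2" | "3 \<le> n" by linarith
  then show ?thesis
  proof cases
    case 1 then show ?thesis by (simp add: heap_boundary_gen_def)
  next
    case 2
    with assms obtain x y z where "xs = [x, y, z]" "x \<in> X" "y \<in> X" "z \<in> X"
      using heap_tuples_2E by metis
    moreover from this have "{[t x y z], [x], [y], [z]} \<subseteq> heap_tuples X 1"
      using closed by (auto simp: heap_tuples_def)
    ultimately show ?thesis
      unfolding 2 by (simp only: heap_boundary_gen_2) (intro keys_add_diff_subset; simp)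
  next
    case 3
    have len: "length xs = 2 * n - 1" using assms 3 by (simp add: heap_tuples_def)
    show ?thesis
      unfolding heap_boundary_gen_faces[OF 3 len]
      by (intro keys_face_sum heap_face_in_tuples) (use assms 3 in auto)
  qed
qed

lemma keys_heap_boundary:
  assumes "Poly_Mapping.keys c \<subseteq> heap_tuples X n"
  shows "Poly_Mapping.keys (heap_boundary t n c) \<subseteq> heap_tuples X (n - 1)"
  unfolding heap_boundary_def using assms keys_heap_boundary_gen by (rule keys_frag_extend_subset)

text \<open>
  From degree 4 on the simplicial identities apply.  The composite from degree 3 to degree 1 involves
  the exceptional differential of degree 2 and is expanded by hand; the extra
  terms \<open>(x\<^sub>2)\<close> of the four faces cancel among themselves.
\<close>

lemma heap_boundary_heap_boundary_gen:
  assumes xs: "xs \<in> heap_tuples X (Suc n)"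
  shows "heap_boundary t n (heap_boundary_gen t (Suc n) xs) = 0"
proof -
  consider "n \<le> 1" | "n = 2" | "3 \<le> n" by linarith
  then show ?thesis
  proof cases
    case 1 then show ?thesis by (rule heap_boundary_le_1)
  next
    case 2
    with xs obtain a b c d f where abc: "xs = [a, b, c, d, f]" "a \<in> X" "b \<in> X" "c \<in> X" "d \<in> X" "f \<in> X"
      using heap_tuples_3E by (metis Suc_1 numeral_2_eq_2 numeral_3_eq_3)
    have "Suc n = 3" using 2 by simp
    with abc 2 show ?thesis
      by (simp add: heap_boundary_gen_3 heap_boundary_def frag_extend_add frag_extend_diff
          frag_extend_minus heap_boundary_gen_2 para_assoc_middle para_assoc_right)
  next
    case 3
    have len: "length xs = 2 * Suc n - 1" and set: "set xs \<subseteq> X"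
      using xs by (auto simp: heap_tuples_def)
    have "heap_boundary t n (frag_of (heap_face t (Suc n) j xs)) =
        (\<Sum>i\<le>n. frag_cmul ((-1) ^ (i + 1)) (frag_of (heap_face t n i (heap_face t (Suc n) j xs))))"
      if "j \<le> Suc n" for j
      using 3 that len length_heap_face[of "Suc n" j xs t]
      by (simp add: heap_boundary_def heap_boundary_gen_faces)
    then have "heap_boundary t n (heap_boundary_gen t (Suc n) xs) =
        (\<Sum>j\<le>Suc n. frag_cmul ((-1) ^ (j + 1))
          (\<Sum>i\<le>n. frag_cmul ((-1) ^ (i + 1)) (frag_of (heap_face t n i (heap_face t (Suc n) j xs)))))"
      using 3 len unfolding heap_boundary_def
      by (subst heap_boundary_gen_faces)
        (auto simp: frag_extend_sum frag_extend_cmul simp del: power_Suc sum.atMost_Suc intro!: sum.cong)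
    also have "\<dots> = 0"
      using 3 len set heap_face_heap_face by (intro alternating_double_sum) auto
    finally show ?thesis .
  qed
qed

lemma heap_boundary_heap_boundary:
  assumes "Poly_Mapping.keys c \<subseteq> heap_tuples X (Suc n)"
  shows "heap_boundary t n (heap_boundary t (Suc n) c) = 0"
proof -
  have "heap_boundary t n (heap_boundary t (Suc n) c) =
      frag_extend (\<lambda>xs. heap_boundary t n (heap_boundary_gen t (Suc n) xs)) c"
    by (simp add: heap_boundary_def frag_extend_frag_extend)
  also have "\<dots> = 0"
    using assms by (intro frag_extend_eq_0 heap_boundary_heap_boundary_gen) auto
  finally show ?thesis .
qed

end

section \<open>The embedding Psi on chains\<close>

lemma length_intersperse: "length (intersperse e xs) = 2 * length xs - 1"
  by (induction e xs rule: intersperse.induct) auto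

lemma set_intersperse: "set (intersperse e xs) \<subseteq> insert e (set xs)"
  by (induction e xs rule: intersperse.induct) auto

lemma intersperse_Cons: "xs \<noteq> [] \<Longrightarrow> intersperse e (x # xs) = x # e # intersperse e xs"
  by (cases xs) auto

lemma intersperse_eq_Nil [simp]: "intersperse e xs = [] \<longleftrightarrow> xs = []"
  by (cases "(e, xs)" rule: intersperse.cases) auto

text \<open>
  Left inverse of \<^const>\<open>intersperse\<close>; its linear extension recovers a group chain from its image.
\<close>

fun alternate_entries :: "'a list \<Rightarrow> 'a list" where
  "alternate_entries (x # y # xs) = x # alternate_entries xs"
| "alternate_entries xs = xs"

lemma alternate_entries_intersperse: "alternate_entries (intersperse e xs) = xs"
  by (induction e xs rule: intersperse.induct) auto

lemma set_alternate_entries: "set (alternate_entries xs) \<subseteq> set xs"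
  by (induction xs rule: alternate_entries.induct) auto

lemma length_alternate_entries: "length (alternate_entries xs) = (length xs + 1) div 2"
  by (induction xs rule: alternate_entries.induct) auto

lemma intersperse_alternate_entries:
  assumes "length xs = 2 * n + 1" "\<forall>i\<in>{1..n}. xs ! (2 * i - 1) = e"
  shows "intersperse e (alternate_entries xs) = xs"
  using assms
proof (induction xs arbitrary: n rule: alternate_entries.induct)
  case (1 x y xs)
  then obtain k where k: "n = Suc k" by (cases n) auto
  have y: "y = e" using 1(3)[rule_format, of 1] k by simp
  have "xs ! (2 * i - 1) = e" if "i \<in> {1..k}" for i
    using 1(3)[rule_format, of "Suc i"] that k by (cases i) auto
  then have "intersperse e (alternate_entries xs) = xs" using 1 k by simp
  moreover have "alternate_entries xs \<noteq> []"
    using length_alternate_entries[of xs] 1(2) k by auto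
  ultimately show ?case using y by (simp add: intersperse_Cons)
qed (use assms in \<open>auto split: list.splits\<close>)

lemma intersperse_nth_odd:
  "1 \<le> i \<Longrightarrow> i < length xs \<Longrightarrow> intersperse e xs ! (2 * i - 1) = e"
proof (induction e xs arbitrary: i rule: intersperse.induct)
  case (3 e x y ys)
  show ?case
  proof (cases "i = 1")
    case False
    then obtain k where "i = Suc (Suc k)" using "3.prems" by (cases i; cases "i - 1") auto
    then show ?thesis using "3.IH"[of "Suc k"] "3.prems" by simp
  qed simp
qed auto

lemma Psi_inverse: "frag_extend (\<lambda>xs. frag_of (alternate_entries xs)) (Psi e v) = v"
  by (simp add: Psi_def frag_extend_frag_extend alternate_entries_intersperse flip: frag_expansion)

lemma Psi_inject: "Psi e v = Psi e w \<longleftrightarrow> v = w"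
  by (metis Psi_inverse)

lemma Psi_0 [simp]: "Psi e 0 = 0" by (simp add: Psi_def)
lemma Psi_add: "Psi e (v + w) = Psi e v + Psi e w" by (simp add: Psi_def frag_extend_add)
lemma Psi_diff: "Psi e (v - w) = Psi e v - Psi e w" by (simp add: Psi_def frag_extend_diff)

lemma intersperse_group_merge:
  "i + 2 \<le> length xs \<Longrightarrow>
    intersperse e (group_merge (\<lambda>x y. t x e y) i xs) = heap_merge t i (intersperse e xs)"
proof (induction i arbitrary: xs)
  case 0
  then obtain x y ys where "xs = x # y # ys" by (auto simp: numeral_eq_Suc Suc_le_length_iff)
  then show ?case by (cases ys) auto
next
  case (Suc i)
  then obtain x ys where xs: "xs = x # ys" "i + 2 \<le> length ys" by (cases xs) auto
  moreover have "ys \<noteq> []" "group_merge (\<lambda>x y. t x e y) i ys \<noteq> []"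
    using xs length_group_merge[of i ys] by (auto simp flip: length_greater_0_conv)
  ultimately show ?case using Suc by (simp add: intersperse_Cons)
qed

lemma intersperse_take:
  "1 \<le> k \<Longrightarrow> k \<le> length xs \<Longrightarrow> intersperse e (take k xs) = take (2 * k - 1) (intersperse e xs)"
proof (induction e xs arbitrary: k rule: intersperse.induct)
  case (3 e x y ys)
  then show ?case
  proof (cases "k = 1")
    case False
    with "3.prems" obtain l where "k = Suc (Suc l)" by (cases k; cases "k - 1") auto
    then show ?thesis using "3.IH"[of "Suc l"] "3.prems" by simp
  qed simp
qed (auto simp: take_Cons split: nat.splits)

text \<open>
  This is where \<open>[x, e, y] = x y\<close> enters: a binary merge of letters becomes a ternary merge across an
  inserted base point, and the letter dropped by an outer face takes one base point with it.
\<close>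

lemma intersperse_group_face:
  assumes "2 \<le> n" "i \<le> n" "length xs = n"
  shows "intersperse e (group_face (\<lambda>x y. t x e y) n i xs) = heap_face t n i (intersperse e xs)"
proof -
  consider "i = 0" | "i = n" | "0 < i" "i < n" using assms by linarith
  then show ?thesis
  proof cases
    case 1
    obtain x y ys where "xs = x # y # ys" using assms by (auto simp: numeral_eq_Suc Suc_le_length_iff)
    then show ?thesis using 1 by (simp add: group_face_def heap_face_def)
  next
    case 2
    have "2 * (n - 1) - 1 = 2 * n - 3" by simp
    then show ?thesis using 2 assms intersperse_take[of "n - 1" xs e]
      by (simp add: group_face_def heap_face_def)
  next
    case 3 then show ?thesis
      using assms by (simp add: group_face_def heap_face_def intersperse_group_merge)
  qed
qed

section \<open>Comparison of the two differentials along Psi\<close>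

locale pointed_heap = heap X t for X :: "'a set" and t +
  fixes e :: 'a
  assumes base: "e \<in> X"

abbreviation words :: "'a set \<Rightarrow> nat \<Rightarrow> 'a list set" where
  "words X n \<equiv> {xs. length xs = n \<and> set xs \<subseteq> X}"

text \<open>
  The sum of coefficients, recorded as a multiple of one generator so that it can be added to chains.
  It measures the failure of \<^const>\<open>Psi\<close> to commute with the differential in degree 2.
\<close>

definition collapse :: "'b \<Rightarrow> ('c \<Rightarrow>\<^sub>0 int) \<Rightarrow> ('b \<Rightarrow>\<^sub>0 int)" where
  "collapse u = frag_extend (\<lambda>_. frag_of u)"

lemma collapse_0 [simp]: "collapse u 0 = 0"
  by (simp add: collapse_def)

lemma collapse_Psi: "collapse u (Psi e v) = collapse u v"
  by (simp add: collapse_def Psi_def frag_extend_frag_extend)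

context pointed_heap
begin

abbreviation G :: "'a monoid" where "G \<equiv> heap_group X t e"

lemma group_chains_words: "group_chains G n = free_Abelian_group (words X n)"
  by (simp add: group_chains_def heap_group_def)

lemma mult_G: "monoid.mult G = (\<lambda>x y. t x e y)"
  by (simp add: heap_group_def)

lemma group_face_in_words:
  assumes "i \<le> n" "1 \<le> n" "xs \<in> words X n"
  shows "group_face (\<lambda>x y. t x e y) n i xs \<in> words X (n - 1)"
proof -
  consider "i = 0" | "i = n" | "0 < i" "i < n" using assms by linarith
  then show ?thesis
  proof cases
    case 3
    then have l: "i - 1 + 2 \<le> length xs" using assms by auto
    have "xs ! (i - 1) \<in> X" "xs ! Suc (i - 1) \<in> X" using l assms by (auto simp: subset_iff)
    then have "t (xs ! (i - 1)) e (xs ! Suc (i - 1)) \<in> X" using closed base by auto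
    then show ?thesis
      using 3 l assms by (auto simp: group_face_def group_merge_conv dest: in_set_takeD in_set_dropD)
  qed (use assms in \<open>auto simp: group_face_def dest!: in_set_takeD in_set_dropD\<close>)
qed

lemma keys_group_boundary:
  assumes "Poly_Mapping.keys v \<subseteq> words X n"
  shows "Poly_Mapping.keys (group_boundary G n v) \<subseteq> words X (n - 1)"
  unfolding group_boundary_def using assms
proof (rule keys_frag_extend_subset)
  fix xs assume xs: "xs \<in> words X n"
  show "Poly_Mapping.keys (group_boundary_gen G n xs) \<subseteq> words X (n - 1)"
  proof (cases "n = 0")
    case True then show ?thesis by (simp add: group_boundary_gen_def)
  next
    case False
    then have n: "1 \<le> n" "length xs = n" using xs by auto
    show ?thesis
      unfolding group_boundary_gen_faces[OF n] mult_G
      using n xs by (intro keys_face_sum group_face_in_words) auto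
  qed
qed

lemma Psi_boundary:
  assumes "3 \<le> n" "Poly_Mapping.keys v \<subseteq> words X n"
  shows "heap_boundary t n (Psi e v) = Psi e (group_boundary G n v)"
proof -
  have "heap_boundary_gen t n (intersperse e xs) = Psi e (group_boundary_gen G n xs)"
    if "length xs = n" for xs
  proof -
    have n: "1 \<le> n" using assms by simp
    show ?thesis
      unfolding group_boundary_gen_faces[OF n that] mult_G using assms(1) that
      by (subst heap_boundary_gen_faces)
        (auto simp: length_intersperse Psi_def frag_extend_sum frag_extend_cmul intersperse_group_face
          simp del: power_Suc intro!: sum.cong)
  qed
  then show ?thesis
    using assms(2) by (auto simp: heap_boundary_def Psi_def group_boundary_def frag_extend_frag_extend
        intro!: frag_extend_eq)
qed

lemma words_2E:
  assumes "xs \<in> words X 2"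
  obtains x y where "xs = [x, y]" "x \<in> X" "y \<in> X"
  using assms by (auto simp: numeral_eq_Suc length_Suc_conv)

text \<open>
  The summand \<open>+ (x\<^sub>2)\<close> of the heap differential contributes \<open>(e)\<close> for every generator \<open>(x, e, y)\<close>.
\<close>

lemma Psi_boundary_2:
  assumes "Poly_Mapping.keys v \<subseteq> words X 2"
  shows "heap_boundary t 2 (Psi e v) = Psi e (group_boundary G 2 v) + collapse [e] v"
proof -
  have "heap_boundary t 2 (Psi e v) = frag_extend (\<lambda>xs. heap_boundary_gen t 2 (intersperse e xs)) v"
    by (simp add: heap_boundary_def Psi_def frag_extend_frag_extend)
  also have "\<dots> = frag_extend (\<lambda>xs. Psi e (group_boundary_gen G 2 xs) + frag_of [e]) v"
  proof (rule frag_extend_eq)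
    fix xs assume "xs \<in> Poly_Mapping.keys v"
    then have "xs \<in> words X 2" using assms by (rule set_rev_mp)
    then obtain x y where "xs = [x, y]" by (rule words_2E)
    then show "heap_boundary_gen t 2 (intersperse e xs) = Psi e (group_boundary_gen G 2 xs) + frag_of [e]"
      by (simp add: heap_boundary_gen_2 group_boundary_gen_2 Psi_def frag_extend_add frag_extend_diff
          frag_extend_minus mult_G)
  qed
  also have "\<dots> = Psi e (group_boundary G 2 v) + collapse [e] v"
    by (simp add: frag_extend_gen_add collapse_def group_boundary_def Psi_def frag_extend_frag_extend)
  finally show ?thesis .
qed

lemma collapse_group_boundary_2:
  assumes "Poly_Mapping.keys v \<subseteq> words X 2"
  shows "collapse u (group_boundary G 2 v) = - collapse u v"
proof -
  have "frag_extend (\<lambda>_. frag_of u) (group_boundary_gen G 2 xs) = - frag_of u" if "xs \<in> words X 2" for xs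
    by (rule words_2E[OF that]) (simp add: group_boundary_gen_2 frag_extend_add frag_extend_diff frag_extend_minus)
  then have "collapse u (group_boundary G 2 v) = frag_extend (\<lambda>_. - frag_of u) v"
    using assms by (auto simp: collapse_def group_boundary_def frag_extend_frag_extend intro!: frag_extend_eq)
  then show ?thesis by (simp add: frag_extend_gen_minus collapse_def)
qed

lemma collapse_heap_boundary:
  assumes "n = 2 \<or> n = 3" "Poly_Mapping.keys c \<subseteq> heap_tuples X n"
  shows "collapse u (heap_boundary t n c) = 0"
proof -
  have "frag_extend (\<lambda>_. frag_of u) (heap_boundary_gen t n xs) = 0" if "xs \<in> heap_tuples X n" for xs
    using assms(1)
  proof
    assume n: "n = 2"
    show ?thesis
      using that unfolding n
      by (rule heap_tuples_2E) (simp add: heap_boundary_gen_2 frag_extend_add frag_extend_diff)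
  next
    assume n: "n = 3"
    show ?thesis
      using that unfolding n
      by (rule heap_tuples_3E)
        (simp add: heap_boundary_gen_3 frag_extend_add frag_extend_diff frag_extend_minus)
  qed
  then show ?thesis
    unfolding collapse_def heap_boundary_def frag_extend_frag_extend
    using assms(2) by - (rule frag_extend_eq_0, blast)
qed

lemma group_boundary_collapse: "group_boundary G 2 (collapse [e, e] v) = - collapse [e] v"
  by (simp add: collapse_def group_boundary_def frag_extend_frag_extend group_boundary_gen_2 mult_G
      left_degenerate base frag_extend_gen_minus)

lemma keys_Psi:
  assumes "1 \<le> n" "Poly_Mapping.keys v \<subseteq> words X n"
  shows "Poly_Mapping.keys (Psi e v) \<subseteq> heap_tuples X n"
  unfolding Psi_def using assms(2)
proof (rule keys_frag_extend_subset)
  fix xs assume "xs \<in> words X n"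
  then show "Poly_Mapping.keys (frag_of (intersperse e xs)) \<subseteq> heap_tuples X n"
    using assms(1) base set_intersperse[of e xs] by (auto simp: heap_tuples_def length_intersperse)
qed

lemma group_boundary_le_1:
  assumes "n \<le> 1" "Poly_Mapping.keys v \<subseteq> words X n"
  shows "group_boundary G n v = 0"
  unfolding group_boundary_def using assms
  by (intro frag_extend_eq_0) (auto simp: group_boundary_gen_def le_Suc_eq length_Suc_conv)

text \<open>
  Transported from the heap complex along the injective map \<^const>\<open>Psi\<close>.  In degree 3 the error of
  \<open>Psi_boundary_2\<close> vanishes because the coefficients of a boundary of degree 3 sum to zero.
\<close>

lemma group_boundary_group_boundary:
  assumes v: "Poly_Mapping.keys v \<subseteq> words X (Suc n)"
  shows "group_boundary G n (group_boundary G (Suc n) v) = 0"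
proof -
  have dv: "Poly_Mapping.keys (group_boundary G (Suc n) v) \<subseteq> words X n"
    using keys_group_boundary[OF v] by simp
  have dd: "heap_boundary t n (heap_boundary t (Suc n) (Psi e v)) = 0"
    using keys_Psi[OF _ v] by (intro heap_boundary_heap_boundary) simp
  consider "n \<le> 1" | "n = 2" | "3 \<le> n" by linarith
  then show ?thesis
  proof cases
    case 1
    then show ?thesis using dv by (rule group_boundary_le_1)
  next
    case 2
    have v3: "Poly_Mapping.keys v \<subseteq> words X 3" using v 2 by (simp add: numeral_3_eq_3)
    have comm: "heap_boundary t 3 (Psi e v) = Psi e (group_boundary G 3 v)"
      using v3 by (intro Psi_boundary) auto
    have "collapse [e] (group_boundary G 3 v) = collapse [e] (heap_boundary t 3 (Psi e v))"
      by (simp add: comm collapse_Psi)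
    also have "\<dots> = 0"
      using keys_Psi[OF _ v3] by (intro collapse_heap_boundary) auto
    finally have "heap_boundary t 2 (heap_boundary t 3 (Psi e v))
        = Psi e (group_boundary G 2 (group_boundary G 3 v))"
      using dv 2 by (simp add: comm Psi_boundary_2)
    then have "Psi e (group_boundary G 2 (group_boundary G 3 v)) = Psi e 0"
      using dd 2 by simp
    then show ?thesis using 2 by (simp only: Psi_inject numeral_2_eq_2 numeral_3_eq_3)
  next
    case 3
    then have "Psi e (group_boundary G n (group_boundary G (Suc n) v)) = Psi e 0"
      using dd v dv by (simp add: Psi_boundary)
    then show ?thesis by (simp only: Psi_inject)
  qed
qed

lemma hat_chains_0: "hat_chains X e 0 = {0}"
  by (auto simp: hat_chains_def heap_tuples_def)

lemma hat_chains_eq_Psi_image: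
  assumes "1 \<le> n"
  shows "hat_chains X e n = Psi e ` {v. Poly_Mapping.keys v \<subseteq> words X n}"
proof (intro equalityI subsetI)
  fix c assume "c \<in> hat_chains X e n"
  then have c: "Poly_Mapping.keys c \<subseteq> {xs \<in> heap_tuples X n. \<forall>i\<in>{1..n - 1}. xs ! (2 * i - 1) = e}"
    by (simp add: hat_chains_def)
  define v where "v = frag_extend (\<lambda>xs. frag_of (alternate_entries xs)) c"
  have "alternate_entries xs \<in> words X n" if "xs \<in> Poly_Mapping.keys c" for xs
    using c that assms set_alternate_entries[of xs]
    by (auto simp: heap_tuples_def length_alternate_entries)
  then have "Poly_Mapping.keys v \<subseteq> words X n"
    unfolding v_def by (intro keys_frag_extend_subset[OF subset_refl]) auto
  moreover have "Psi e v = c"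
  proof -
    have "intersperse e (alternate_entries xs) = xs" if "xs \<in> Poly_Mapping.keys c" for xs
      using c that assms by (intro intersperse_alternate_entries[of _ "n - 1"]) (auto simp: heap_tuples_def)
    then have "Psi e v = frag_extend frag_of c"
      by (auto simp: v_def Psi_def frag_extend_frag_extend intro!: frag_extend_eq)
    then show ?thesis by (simp flip: frag_expansion)
  qed
  ultimately show "c \<in> Psi e ` {v. Poly_Mapping.keys v \<subseteq> words X n}" by blast
next
  fix c assume "c \<in> Psi e ` {v. Poly_Mapping.keys v \<subseteq> words X n}"
  then obtain v where v: "Poly_Mapping.keys v \<subseteq> words X n" "c = Psi e v" by auto
  have "intersperse e xs \<in> {xs \<in> heap_tuples X n. \<forall>i\<in>{1..n - 1}. xs ! (2 * i - 1) = e}"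
    if "xs \<in> words X n" for xs
  proof -
    have "\<forall>i\<in>{1..n - 1}. intersperse e xs ! (2 * i - 1) = e"
      using that assms by (intro ballI intersperse_nth_odd) auto
    then show ?thesis
      using that assms base set_intersperse[of e xs] by (auto simp: heap_tuples_def length_intersperse)
  qed
  then show "c \<in> hat_chains X e n"
    unfolding hat_chains_def v(2) Psi_def carrier_free_Abelian_group_iff using v(1)
    by (intro keys_frag_extend_subset[where S = "words X n"]) auto
qed

text \<open>
  In degree 2 the error \<open>\<epsilon>(v) (e)\<close> is itself a group boundary, so it is absorbed by replacing \<open>v\<close> with
  \<open>v - \<epsilon>(v) (e, e)\<close>.  This makes the connecting map independent of the chosen lift.
\<close>

lemma Psi_boundary_mod:
  assumes n: "1 \<le> n" and h: "h \<in> hat_chains X e n"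
  obtains b where "b \<in> boundaries (group_chains G) (group_boundary G) (n - 1)" "heap_boundary t n h = Psi e b"
proof -
  obtain v where v: "Poly_Mapping.keys v \<subseteq> words X n" "h = Psi e v"
    using h n by (auto simp: hat_chains_eq_Psi_image)
  have bd: "group_boundary G n w \<in> boundaries (group_chains G) (group_boundary G) (n - 1)"
    if "Poly_Mapping.keys w \<subseteq> words X n" for w
    using that n by (auto simp: boundaries_def group_chains_words)
  consider "n = 1" | "n = 2" | "3 \<le> n" using n by linarith
  then show ?thesis
  proof cases
    case 1
    have "group_boundary G n 0 = 0" by (simp add: group_boundary_def)
    then show ?thesis
      using bd[of 0] 1 by (intro that[of 0]) (auto simp: heap_boundary_le_1)
  next
    case 2
    have "Poly_Mapping.keys (collapse [e, e] v) \<subseteq> words X 2"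
      unfolding collapse_def using base by (intro keys_frag_extend_subset[OF subset_refl]) auto
    moreover have "heap_boundary t 2 h = Psi e (group_boundary G 2 (v - collapse [e, e] v))"
    proof -
      have "Psi e (collapse [e] v) = collapse [e] v"
        by (simp add: Psi_def collapse_def frag_extend_frag_extend)
      then show ?thesis
        using v 2 Psi_boundary_2[of v] group_boundary_collapse[of v]
        by (simp add: group_boundary_def frag_extend_diff Psi_diff Psi_add)
    qed
    moreover from calculation(1) have "Poly_Mapping.keys (v - collapse [e, e] v) \<subseteq> words X n"
      using v 2 by (intro keys_add_diff_subset) simp_all
    ultimately show ?thesis
      using 2 by (intro that[OF bd[of "v - collapse [e, e] v"]]) simp_all
  next
    case 3
    then show ?thesis using v bd[of v] by (intro that[of "group_boundary G n v"]) (auto simp: Psi_boundary)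
  qed
qed

end

section \<open>A retraction of Psi\<close>

text \<open>
  The word \<open>q\<^sub>u (x\<^sub>1, y\<^sub>1, \<dots>, x\<^sub>n)\<close> of the introduction; the last entry of the tuple is replaced by \<open>u\<close>.
\<close>

fun quotients :: "('a \<Rightarrow> 'a \<Rightarrow> 'a \<Rightarrow> 'a) \<Rightarrow> 'a \<Rightarrow> 'a \<Rightarrow> 'a list \<Rightarrow> 'a list" where
  "quotients t e u (x # y # zs) = t x y e # quotients t e u zs"
| "quotients t e u [x] = [u]"
| "quotients t e u [] = []"

text \<open>
  For \<open>xs = (x\<^sub>1, y\<^sub>1, \<dots>, x\<^sub>n)\<close> with \<open>n \<ge> 2\<close>, the letters put in the last place are \<open>x\<^sub>n\<close>, \<open>y\<^sub>n\<^sub>-\<^sub>1\<close> and \<open>e\<close>.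
\<close>

definition Phi_gen :: "('a \<Rightarrow> 'a \<Rightarrow> 'a \<Rightarrow> 'a) \<Rightarrow> 'a \<Rightarrow> 'a list \<Rightarrow> 'a list \<Rightarrow>\<^sub>0 int" where
  "Phi_gen t e xs = frag_of (quotients t e (last xs) xs)
    - frag_of (quotients t e (last (butlast xs)) xs) + frag_of (quotients t e e xs)"

definition Phi :: "('a \<Rightarrow> 'a \<Rightarrow> 'a \<Rightarrow> 'a) \<Rightarrow> 'a \<Rightarrow> ('a list \<Rightarrow>\<^sub>0 int) \<Rightarrow> ('a list \<Rightarrow>\<^sub>0 int)" where
  "Phi t e = frag_extend (Phi_gen t e)"

lemma length_quotients: "length (quotients t e u xs) = (length xs + 1) div 2"
  by (induction t e u xs rule: quotients.induct) auto

lemma last_intersperse: "xs \<noteq> [] \<Longrightarrow> last (intersperse e xs) = last xs"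
  by (induction e xs rule: intersperse.induct) auto

lemma last_butlast_intersperse: "2 \<le> length xs \<Longrightarrow> last (butlast (intersperse e xs)) = e"
proof (induction e xs rule: intersperse.induct)
  case (3 e x y ys) then show ?case by (cases ys) auto
qed auto

lemma heap_tuples_iff: "1 \<le> n \<Longrightarrow> xs \<in> heap_tuples X n \<longleftrightarrow> length xs = 2 * n - 1 \<and> set xs \<subseteq> X"
  by (simp add: heap_tuples_def)

lemma quotients_intersperse:
  assumes "\<And>x. x \<in> set xs \<Longrightarrow> t x e e = x" "xs \<noteq> []"
  shows "quotients t e u (intersperse e xs) = butlast xs @ [u]"
  using assms by (induction e xs rule: intersperse.induct) auto

lemma quotients_drop:
  "3 \<le> length xs \<Longrightarrow> quotients t e u (drop 2 xs) = drop 1 (quotients t e u xs)"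
  by (auto simp: numeral_eq_Suc Suc_le_length_iff)

text \<open>
  Dropping the free letter leaves a word that ends in the quotient \<open>[x, y, e]\<close>, which is the word of
  the shortened tuple with that quotient as its free letter.
\<close>

lemma take_quotients:
  assumes "length xs = 2 * k + 1" "1 \<le> k"
  shows "take k (quotients t e u xs) =
    quotients t e (t (last (take (2 * k - 1) xs)) (last (butlast xs)) e) (take (2 * k - 1) xs)"
  using assms
proof (induction k arbitrary: xs)
  case (Suc k)
  then obtain x y zs where xs: "xs = x # y # zs" "length zs = 2 * k + 1"
    by (auto simp: length_Suc_conv)
  show ?case
  proof (cases k)
    case 0
    with xs obtain z where "zs = [z]" by (auto simp: length_Suc_conv)
    then show ?thesis using xs 0 by simp
  next
    case (Suc l)
    have "zs \<noteq> []" "butlast zs \<noteq> []" "take (Suc (2 * l)) zs \<noteq> []" using xs Suc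
      by (auto simp flip: length_greater_0_conv)
    then show ?thesis using Suc.IH[of zs] xs Suc by simp
  qed
qed simp

context pointed_heap
begin

lemma set_quotients: "set xs \<subseteq> X \<Longrightarrow> u \<in> X \<Longrightarrow> set (quotients t e u xs) \<subseteq> X"
  by (induction t\<equiv>t e\<equiv>e u xs rule: quotients.induct) (auto simp: closed base)

lemma quotients_in_words:
  "1 \<le> n \<Longrightarrow> xs \<in> heap_tuples X n \<Longrightarrow> u \<in> X \<Longrightarrow> quotients t e u xs \<in> words X n"
  using set_quotients by (auto simp: heap_tuples_def length_quotients)

lemma group_merge_quotients:
  assumes "set xs \<subseteq> X" "2 * i + 5 \<le> length xs" "odd (length xs)"
  shows "group_merge (\<lambda>x y. t x e y) i (quotients t e u xs) = quotients t e u (heap_merge t i xs)"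
  using assms
proof (induction i arbitrary: xs)
  case 0
  then obtain x y z w v zs where "xs = x # y # z # w # v # zs"
    by (auto simp: numeral_eq_Suc Suc_le_length_iff)
  then show ?case
    using 0 by (simp add: para_assoc_middle para_assoc_right left_degenerate closed base)
next
  case (Suc i)
  then obtain x y zs where "xs = x # y # zs"
    by (auto simp: numeral_eq_Suc Suc_le_length_iff)
  then show ?case using Suc by simp
qed

text \<open>
  Multiplying the last two letters computes \<open>[x, y, e] u = [x, y, u]\<close>, and the last quotient thereby
  moves into the final letter.
\<close>

lemma group_merge_last_quotients:
  assumes "set xs \<subseteq> X" "length xs = 2 * i + 3" "u \<in> X"
  shows "group_merge (\<lambda>x y. t x e y) i (quotients t e u xs) =
    quotients t e (t (last (take (2 * i + 1) xs)) (last (butlast xs)) u) (take (2 * i + 1) xs)"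
  using assms
proof (induction i arbitrary: xs)
  case 0
  then obtain x y z where "xs = [x, y, z]"
    by (auto simp: numeral_eq_Suc length_Suc_conv)
  then show ?case
    using 0 by (simp add: para_assoc_middle para_assoc_right left_degenerate closed base)
next
  case (Suc i)
  then obtain x y zs where xs: "xs = x # y # zs" "length zs = 2 * i + 3"
    by (auto simp: numeral_eq_Suc length_Suc_conv)
  moreover from this have "zs \<noteq> []" "butlast zs \<noteq> []" "take (Suc (2 * i)) zs \<noteq> []"
    by (auto simp flip: length_greater_0_conv)
  ultimately show ?case using Suc.IH[of zs] Suc.prems by simp
qed

lemma quotients_last_indep:
  "odd (length xs) \<Longrightarrow> quotients t e u (butlast xs @ [w]) = quotients t e u xs"
proof (induction t e u xs rule: quotients.induct)
  case (1 t e u x y zs) then show ?case by (cases zs) auto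
qed auto

lemma Phi_Psi:
  assumes "2 \<le> n" "Poly_Mapping.keys v \<subseteq> words X n"
  shows "Phi t e (Psi e v) = v"
proof -
  have "Phi_gen t e (intersperse e xs) = frag_of xs" if "xs \<in> words X n" for xs
  proof -
    have "t x e e = x" if "x \<in> set xs" for x
      using that \<open>xs \<in> words X n\<close> base right_degenerate by auto
    then have "quotients t e u (intersperse e xs) = butlast xs @ [u]" for u
      using that assms(1) by (intro quotients_intersperse) auto
    moreover have "2 \<le> length xs" "xs \<noteq> []" using that assms(1) by auto
    ultimately show ?thesis by (simp add: Phi_gen_def last_intersperse last_butlast_intersperse)
  qed
  then have "Phi t e (Psi e v) = frag_extend frag_of v"
    unfolding Phi_def Psi_def frag_extend_frag_extend using assms(2)
    by - (rule frag_extend_eq, auto)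
  then show ?thesis by (simp flip: frag_expansion)
qed

lemma keys_Phi:
  assumes "2 \<le> n" "Poly_Mapping.keys c \<subseteq> heap_tuples X n"
  shows "Poly_Mapping.keys (Phi t e c) \<subseteq> words X n"
  unfolding Phi_def using assms(2)
proof (rule keys_frag_extend_subset)
  fix xs assume xs: "xs \<in> heap_tuples X n"
  then have len: "length xs = 2 * n - 1" and set: "set xs \<subseteq> X"
    using assms(1) by (simp_all add: heap_tuples_iff)
  have "xs \<noteq> []" "butlast xs \<noteq> []"
    using len assms(1) by (simp_all flip: length_greater_0_conv)
  then have "last xs \<in> X" "last (butlast xs) \<in> X"
    using set last_in_set in_set_butlastD[OF last_in_set] by blast+
  then show "Poly_Mapping.keys (Phi_gen t e xs) \<subseteq> words X n"
    unfolding Phi_gen_def using assms(1) xs base quotients_in_words[of n xs] by (intro keys_add_diff_subset) auto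
qed

text \<open>
  In degree 1 the role of \<^const>\<open>Phi\<close> is taken by the identity.  The error term is the counterpart of the
  one in \<open>Psi_boundary_2\<close>, and again it is a group boundary.
\<close>

lemma Phi_boundary_2:
  assumes "Poly_Mapping.keys c \<subseteq> heap_tuples X 2"
  shows "group_boundary G 2 (Phi t e c) = heap_boundary t 2 c - collapse [e] c"
proof -
  have "group_boundary G 2 (Phi t e c) = frag_extend (\<lambda>xs. group_boundary G 2 (Phi_gen t e xs)) c"
    by (simp add: group_boundary_def Phi_def frag_extend_frag_extend)
  also have "\<dots> = frag_extend (\<lambda>xs. heap_boundary_gen t 2 xs - frag_of [e]) c"
  proof (rule frag_extend_eq)
    fix xs assume "xs \<in> Poly_Mapping.keys c"
    then have "xs \<in> heap_tuples X 2" using assms by (rule set_rev_mp)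
    then obtain x y z where xyz: "xs = [x, y, z]" "x \<in> X" "y \<in> X" "z \<in> X" by (rule heap_tuples_2E)
    have q: "t (t x y e) e u = t x y u" if "u \<in> X" for u
      using that xyz base closed by (simp add: para_assoc_middle para_assoc_right left_degenerate)
    show "group_boundary G 2 (Phi_gen t e xs) = heap_boundary_gen t 2 xs - frag_of [e]"
      using xyz base
      by (simp add: group_boundary_def Phi_gen_def group_boundary_gen_2 heap_boundary_gen_2 mult_G
          frag_extend_add frag_extend_diff q right_degenerate)
  qed
  also have "\<dots> = heap_boundary t 2 c - collapse [e] c"
    by (simp add: frag_extend_gen_diff heap_boundary_def collapse_def)
  finally show ?thesis .
qed

text \<open>
  The first \<open>k + 1\<close> faces of the word come from faces of the tuple.  The last two depend on \<open>xs\<close>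
  only through its truncation \<open>w\<close> and the final letter that they produce.
\<close>

lemma group_boundary_quotients:
  assumes n: "n = k + 2" "1 \<le> k" and xs: "xs \<in> heap_tuples X n" and u: "u \<in> X"
  defines "w \<equiv> take (2 * n - 3) xs"
  shows "group_boundary_gen G n (quotients t e u xs) =
    (\<Sum>i\<le>k. frag_cmul ((-1) ^ (i + 1)) (frag_of (quotients t e u (heap_face t n i xs))))
    + frag_cmul ((-1) ^ k) (frag_of (quotients t e (t (last w) (last (butlast xs)) u) w))
    - frag_cmul ((-1) ^ k) (frag_of (quotients t e (t (last w) (last (butlast xs)) e) w))"
proof -
  let ?m = "\<lambda>x y. t x e y" and ?q = "quotients t e u xs"
  have len: "length xs = 2 * k + 3" and set: "set xs \<subseteq> X"
    using xs n by (simp_all add: heap_tuples_def)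
  have w: "w = take (2 * k + 1) xs" by (simp add: w_def n)
  have "group_face ?m n i ?q = quotients t e u (heap_face t n i xs)" if i: "i \<le> k" for i
  proof (cases i)
    case 0
    then show ?thesis using len by (simp add: group_face_def heap_face_def quotients_drop)
  next
    case (Suc j)
    then show ?thesis
      using i n len set by (simp add: group_face_def heap_face_def group_merge_quotients)
  qed
  moreover have "group_face ?m n (Suc k) ?q = quotients t e (t (last w) (last (butlast xs)) u) w"
    using len set u n by (simp add: group_face_def w group_merge_last_quotients)
  moreover have "group_face ?m n (Suc (Suc k)) ?q = quotients t e (t (last w) (last (butlast xs)) e) w"
    using len n take_quotients[of xs "Suc k" t e u] by (simp add: group_face_def w)
  moreover have "length ?q = n" "1 \<le> n" using len n by (simp_all add: length_quotients)
  ultimately show ?thesis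
    using n by (subst group_boundary_gen_faces) (simp_all add: mult_G)
qed

text \<open>
  In the sum over \<open>u = z, y, e\<close> with signs \<open>+, -, +\<close> the last two faces contribute
  \<open>\<plusminus> (q\<^bsub>[x,y,z]\<^esub> w - q\<^sub>x w)\<close>: the word ending in \<open>[x, y, e]\<close> occurs in both and cancels.  On the other side the
  correction terms of \<^const>\<open>Phi_gen\<close> agree on the last two faces of the tuple, which have opposite
  signs, and the same difference remains.
\<close>

lemma Phi_boundary_gen:
  assumes "3 \<le> n" and xs: "xs \<in> heap_tuples X n"
  shows "group_boundary G n (Phi_gen t e xs) = Phi t e (heap_boundary_gen t n xs)"
proof -
  obtain k where n: "n = k + 2" "1 \<le> k"
  proof
    show "n = (n - 2) + 2" "1 \<le> n - 2" using assms(1) by auto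
  qed
  have len: "length xs = 2 * k + 3" and set: "set xs \<subseteq> X"
    using xs n by (simp_all add: heap_tuples_def)
  define w where "w = take (2 * n - 3) xs"
  have w: "w = take (2 * k + 1) xs" by (simp add: w_def n)
  define x y z where "x = last w" and "y = last (butlast xs)" and "z = last xs"
  have "xs \<noteq> []" "butlast xs \<noteq> []" "w \<noteq> []"
    using len w by (simp_all flip: length_greater_0_conv)
  then have X: "x \<in> X" "y \<in> X" "z \<in> X"
    using set last_in_set[of xs] in_set_butlastD[OF last_in_set[of "butlast xs"]]
      in_set_takeD[OF last_in_set[of w, unfolded w]]
    by (auto simp: x_def y_def z_def w)
  let ?F = "\<lambda>u v. frag_of (quotients t e u v)"
  let ?s = "(-1 :: int) ^ k"
  define S where "S u = (\<Sum>i\<le>k. frag_cmul ((-1) ^ (i + 1)) (?F u (heap_face t n i xs)))" for u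
  have bd: "group_boundary_gen G n (quotients t e u xs) =
      S u + frag_cmul ?s (?F (t x y u) w) - frag_cmul ?s (?F (t x y e) w)" if "u \<in> X" for u
    using group_boundary_quotients[OF n xs that] by (simp add: S_def x_def y_def w_def)
  have inner: "Phi_gen t e (heap_face t n i xs) =
      ?F z (heap_face t n i xs) - ?F y (heap_face t n i xs) + ?F e (heap_face t n i xs)" if i: "i \<le> k" for i
  proof -
    have "last (heap_face t n i xs) = z \<and> last (butlast (heap_face t n i xs)) = y"
    proof (cases i)
      case 0
      then show ?thesis using len n by (simp add: heap_face_def z_def y_def butlast_drop flip: drop_butlast)
    next
      case (Suc j)
      then show ?thesis using len n i
        by (simp add: heap_face_def z_def y_def last_heap_merge last_butlast_heap_merge)
    qed
    then show ?thesis by (simp add: Phi_gen_def)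
  qed
  have outer: "Phi_gen t e w = ?F x w - ?F (last (butlast w)) w + ?F e w"
    by (simp add: Phi_gen_def x_def)
  have hm: "heap_face t n (Suc k) xs = butlast w @ [t x y z]"
  proof -
    have "\<exists>a b c. ys = [a, b, c]" if "length ys = 3" for ys :: "'a list"
      using that by (auto simp: numeral_3_eq_3 length_Suc_conv)
    from this[of "drop (2 * k) xs"] obtain a b c where "drop (2 * k) xs = [a, b, c]"
      using len by auto
    then have "xs = take (2 * k) xs @ [a, b, c]" by (metis append_take_drop_id)
    moreover have "length (take (2 * k) xs) = 2 * k" using len by simp
    ultimately obtain zs where "xs = zs @ [a, b, c]" "length zs = 2 * k" by metis
    then show ?thesis
      using n by (simp add: heap_face_def heap_merge_conv x_def y_def z_def w nth_append butlast_append)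
  qed
  have "odd (length w)" using len by (simp add: w)
  then have "quotients t e u (butlast w @ [t x y z]) = quotients t e u w" for u
    by (rule quotients_last_indep)
  moreover have "last (butlast (butlast w @ [t x y z])) = last (butlast w)" by simp
  ultimately have merge_last: "Phi_gen t e (heap_face t n (Suc k) xs) =
      ?F (t x y z) w - ?F (last (butlast w)) w + ?F e w"
    by (simp add: Phi_gen_def hm)
  have "group_boundary G n (Phi_gen t e xs) =
      (S z - S y + S e) + frag_cmul ?s (?F (t x y z) w) - frag_cmul ?s (?F x w)"
    using X base bd[of z] bd[of y] bd[of e]
    by (simp add: group_boundary_def Phi_gen_def frag_extend_add frag_extend_diff right_degenerate
        flip: y_def z_def)
  also have "S z - S y + S e = (\<Sum>i\<le>k. frag_cmul ((-1) ^ (i + 1)) (Phi_gen t e (heap_face t n i xs)))"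
    by (simp add: S_def inner frag_cmul_distrib2 frag_cmul_diff sum.distrib sum_subtractf)
  also have "\<dots> + frag_cmul ?s (?F (t x y z) w) - frag_cmul ?s (?F x w) =
      (\<Sum>i\<le>Suc (Suc k). frag_cmul ((-1) ^ (i + 1)) (Phi_gen t e (heap_face t n i xs)))"
  proof -
    have "heap_face t n (Suc (Suc k)) xs = w" by (simp add: heap_face_def w_def n)
    then show ?thesis by (simp add: merge_last outer frag_cmul_distrib2 frag_cmul_diff flip: minus_frag_cmul)
  qed
  also have "\<dots> = Phi t e (heap_boundary_gen t n xs)"
    using assms xs n by (subst heap_boundary_gen_faces)
      (simp_all add: heap_tuples_def Phi_def frag_extend_add frag_extend_sum frag_extend_cmul o_def)
  finally show ?thesis .
qed

lemma Phi_boundary: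
  assumes "3 \<le> n" "Poly_Mapping.keys c \<subseteq> heap_tuples X n"
  shows "group_boundary G n (Phi t e c) = Phi t e (heap_boundary t n c)"
proof -
  have "frag_extend (group_boundary_gen G n) (Phi_gen t e xs) = frag_extend (Phi_gen t e) (heap_boundary_gen t n xs)"
    if "xs \<in> Poly_Mapping.keys c" for xs
    using Phi_boundary_gen[OF assms(1), of xs] assms(2) that by (auto simp: group_boundary_def Phi_def)
  then show ?thesis
    unfolding group_boundary_def Phi_def heap_boundary_def frag_extend_frag_extend
    by (rule frag_extend_eq)
qed

end

section \<open>Homology classes and the exact sequence\<close>

lemma frag_extend_hom:
  assumes "\<And>c. Poly_Mapping.keys c \<subseteq> S \<Longrightarrow> Poly_Mapping.keys (frag_extend f c) \<subseteq> T"
  shows "frag_extend f \<in> hom (free_Abelian_group S) (free_Abelian_group T)"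
  using assms by (intro homI) (auto simp: frag_extend_add)

lemma subgroup_free_Abelian_group:
  assumes "S' \<subseteq> S"
  shows "subgroup (carrier (free_Abelian_group S')) (free_Abelian_group S)"
proof (rule group.subgroupI[OF group_free_Abelian_group])
  show "carrier (free_Abelian_group S') \<subseteq> carrier (free_Abelian_group S)"
    using assms by auto
  have "0 \<in> carrier (free_Abelian_group S')" by simp
  then show "carrier (free_Abelian_group S') \<noteq> {}" by blast
next
  fix a assume "a \<in> carrier (free_Abelian_group S')"
  then have "Poly_Mapping.keys a \<subseteq> S'" "Poly_Mapping.keys a \<subseteq> S" using assms by auto
  then show "inv\<^bsub>free_Abelian_group S\<^esub> a \<in> carrier (free_Abelian_group S')" by simp
next
  fix a b assume "a \<in> carrier (free_Abelian_group S')" "b \<in> carrier (free_Abelian_group S')"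
  then show "a \<otimes>\<^bsub>free_Abelian_group S\<^esub> b \<in> carrier (free_Abelian_group S')"
    unfolding mult_free_Abelian_group carrier_free_Abelian_group_iff by (rule keys_add_diff_subset)
qed

lemma r_coset_free_Abelian_group: "H #>\<^bsub>free_Abelian_group S\<^esub> c = (\<lambda>h. h + c) ` H"
  by (auto simp: r_coset_def)

lemma r_coset_free_Abelian_group_eq_iff:
  assumes "subgroup H (free_Abelian_group S)"
  shows "H #>\<^bsub>free_Abelian_group S\<^esub> c = H #>\<^bsub>free_Abelian_group S\<^esub> c' \<longleftrightarrow> c - c' \<in> H"
proof
  interpret H: subgroup H "free_Abelian_group S" by fact
  have add: "x + y \<in> H" if "x \<in> H" "y \<in> H" for x y using H.m_closed that by simp
  have minus: "- x \<in> H" if "x \<in> H" for x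
  proof -
    have "Poly_Mapping.keys x \<subseteq> S" using H.mem_carrier[OF that] by simp
    then show ?thesis using H.m_inv_closed[OF that] by simp
  qed
  have zero: "0 \<in> H" using H.one_closed by simp
  {
    assume "H #>\<^bsub>free_Abelian_group S\<^esub> c = H #>\<^bsub>free_Abelian_group S\<^esub> c'"
    then have "(\<lambda>h. h + c) ` H = (\<lambda>h. h + c') ` H" by (simp add: r_coset_free_Abelian_group)
    moreover have "c \<in> (\<lambda>h. h + c) ` H" using zero by (force intro: image_eqI[of _ _ 0])
    ultimately obtain h where "h \<in> H" "c = h + c'" by auto
    then show "c - c' \<in> H" by simp
  next
    assume d: "c - c' \<in> H"
    have "h + c = (h + (c - c')) + c'" "h + c' = (h + - (c - c')) + c" for h by simp_all
    then show "H #>\<^bsub>free_Abelian_group S\<^esub> c = H #>\<^bsub>free_Abelian_group S\<^esub> c'"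
      using add d minus[OF d] unfolding r_coset_free_Abelian_group
      by (intro equalityI subsetI; elim imageE) (metis image_eqI)+
  }
qed

context pointed_heap
begin

lemma abelian_complex_group: "abelian_complex (group_chains G) (group_boundary G)"
proof (rule abelian_complex.intro)
  fix n
  show "comm_group (group_chains G n)" by (simp add: group_chains_words abelian_free_Abelian_group)
  show "group_boundary G n \<in> hom (group_chains G n) (group_chains G (n - 1))"
    using keys_group_boundary[of _ n] unfolding group_chains_words group_boundary_def
    by (rule frag_extend_hom)
  show "group_boundary G n (group_boundary G (Suc n) c) = \<one>\<^bsub>group_chains G (n - 1)\<^esub>"
    if "c \<in> carrier (group_chains G (Suc n))" for c
    using that group_boundary_group_boundary[of c n] by (simp add: group_chains_words)
qed

lemma abelian_complex_heap: "abelian_complex (heap_chains X) (heap_boundary t)"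
proof (rule abelian_complex.intro)
  fix n
  show "comm_group (heap_chains X n)" by (simp add: heap_chains_def abelian_free_Abelian_group)
  show "heap_boundary t n \<in> hom (heap_chains X n) (heap_chains X (n - 1))"
    using keys_heap_boundary[of _ n] unfolding heap_chains_def heap_boundary_def
    by (rule frag_extend_hom)
  show "heap_boundary t n (heap_boundary t (Suc n) c) = \<one>\<^bsub>heap_chains X (n - 1)\<^esub>"
    if "c \<in> carrier (heap_chains X (Suc n))" for c
    using that heap_boundary_heap_boundary[of c n] by (simp add: heap_chains_def)
qed

sublocale GC: abelian_complex "group_chains G" "group_boundary G"
  by (rule abelian_complex_group)

sublocale HC: abelian_complex "heap_chains X" "heap_boundary t"
  by (rule abelian_complex_heap)

lemma heap_boundary_0 [simp]: "heap_boundary t n 0 = 0"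
  and heap_boundary_add: "heap_boundary t n (a + b) = heap_boundary t n a + heap_boundary t n b"
  and heap_boundary_diff: "heap_boundary t n (a - b) = heap_boundary t n a - heap_boundary t n b"
  by (simp_all add: heap_boundary_def frag_extend_add frag_extend_diff)

lemma carrier_group_chains: "v \<in> carrier (group_chains G n) \<longleftrightarrow> Poly_Mapping.keys v \<subseteq> words X n"
  by (simp add: group_chains_words)

lemma carrier_heap_chains: "c \<in> carrier (heap_chains X n) \<longleftrightarrow> Poly_Mapping.keys c \<subseteq> heap_tuples X n"
  by (simp add: heap_chains_def)

lemma mult_chains [simp]:
  "v \<otimes>\<^bsub>group_chains G n\<^esub> w = v + w" "a \<otimes>\<^bsub>heap_chains X n\<^esub> b = a + b"
  "\<one>\<^bsub>group_chains G n\<^esub> = 0" "\<one>\<^bsub>heap_chains X n\<^esub> = 0"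
  by (simp_all add: group_chains_words heap_chains_def)

lemma subgroup_hat: "subgroup (hat_chains X e n) (heap_chains X n)"
  unfolding heap_chains_def hat_chains_def by (rule subgroup_free_Abelian_group) blast

lemma hat_closed: "h \<in> hat_chains X e n \<Longrightarrow> h \<in> carrier (heap_chains X n)"
  using subgroup.subset[OF subgroup_hat] by blast

lemma heap_boundary_hat:
  assumes h: "h \<in> hat_chains X e n"
  shows "heap_boundary t n h \<in> hat_chains X e (n - 1)"
proof (cases "n \<le> 1")
  case True
  then show ?thesis using hat_chains_0 by (cases n) (auto simp: heap_boundary_le_1)
next
  case False
  then obtain b where "b \<in> boundaries (group_chains G) (group_boundary G) (n - 1)" "heap_boundary t n h = Psi e b"
    using Psi_boundary_mod[OF _ h] by auto
  then show ?thesis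
    using False GC.subgroup_boundaries[of "n - 1"]
    by (auto simp: hat_chains_eq_Psi_image dest!: subgroup.subset subsetD simp: carrier_group_chains)
qed

abbreviation relclass :: "nat \<Rightarrow> ('a list \<Rightarrow>\<^sub>0 int) \<Rightarrow> ('a list \<Rightarrow>\<^sub>0 int) set" where
  "relclass n c \<equiv> hat_chains X e n #>\<^bsub>heap_chains X n\<^esub> c"

lemma relclass_eq_iff: "relclass n c = relclass n c' \<longleftrightarrow> c - c' \<in> hat_chains X e n"
  using r_coset_free_Abelian_group_eq_iff[OF subgroup_hat[unfolded heap_chains_def]]
  by (simp add: heap_chains_def)

lemma relclass_0: "relclass n 0 = hat_chains X e n"
  by (simp add: heap_chains_def r_coset_free_Abelian_group)

lemma relclass_eq_hat_iff: "relclass n c = hat_chains X e n \<longleftrightarrow> c \<in> hat_chains X e n"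
  using relclass_eq_iff[of n c 0] by (simp add: relclass_0)

lemma carrier_rel_chains: "carrier (rel_chains X e n) = relclass n ` carrier (heap_chains X n)"
  by (simp add: rel_chains_def carrier_FactGroup)

lemma one_rel_chains [simp]: "\<one>\<^bsub>rel_chains X e n\<^esub> = hat_chains X e n"
  by (simp add: rel_chains_def)

lemma comm_group_rel_chains: "comm_group (rel_chains X e n)"
  unfolding rel_chains_def by (rule comm_group.abelian_FactGroup[OF HC.comm subgroup_hat])

lemma mult_relclass:
  assumes "a \<in> carrier (heap_chains X n)" "b \<in> carrier (heap_chains X n)"
  shows "relclass n a \<otimes>\<^bsub>rel_chains X e n\<^esub> relclass n b = relclass n (a + b)"
proof -
  have "hat_chains X e n \<lhd> heap_chains X n"
    using comm_group.subgroup_imp_normal[OF HC.comm subgroup_hat] .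
  then show ?thesis using assms by (simp add: rel_chains_def normal.rcos_sum)
qed

lemma group_chains_add_closed:
  "v \<in> carrier (group_chains G n) \<Longrightarrow> w \<in> carrier (group_chains G n) \<Longrightarrow> v + w \<in> carrier (group_chains G n)"
  unfolding carrier_group_chains by (rule keys_add_diff_subset)

lemma heap_chains_add_closed:
  "a \<in> carrier (heap_chains X n) \<Longrightarrow> b \<in> carrier (heap_chains X n) \<Longrightarrow> a + b \<in> carrier (heap_chains X n)"
  "a \<in> carrier (heap_chains X n) \<Longrightarrow> b \<in> carrier (heap_chains X n) \<Longrightarrow> a - b \<in> carrier (heap_chains X n)"
  unfolding carrier_heap_chains by (rule keys_add_diff_subset; assumption)+

lemma heap_boundary_closed:
  "c \<in> carrier (heap_chains X n) \<Longrightarrow> heap_boundary t n c \<in> carrier (heap_chains X (n - 1))"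
  using HC.hom[of n] by (rule hom_in_carrier)

lemma rel_boundary_relclass:
  assumes "c \<in> carrier (heap_chains X n)"
  shows "rel_boundary X t e n (relclass n c) = relclass (n - 1) (heap_boundary t n c)"
  unfolding rel_boundary_def
  using assms heap_boundary_hat
  by (intro induced_coset HC.comm subgroup_hat HC.hom) auto

lemma abelian_complex_rel: "abelian_complex (rel_chains X e) (rel_boundary X t e)"
proof (rule abelian_complex.intro)
  fix n
  show "comm_group (rel_chains X e n)" by (rule comm_group_rel_chains)
  show "rel_boundary X t e n \<in> hom (rel_chains X e n) (rel_chains X e (n - 1))"
  proof (rule homI)
    fix A assume "A \<in> carrier (rel_chains X e n)"
    then show "rel_boundary X t e n A \<in> carrier (rel_chains X e (n - 1))"
      using heap_boundary_closed by (auto simp: carrier_rel_chains rel_boundary_relclass)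
  next
    fix A B assume "A \<in> carrier (rel_chains X e n)" "B \<in> carrier (rel_chains X e n)"
    then obtain a b where ab: "a \<in> carrier (heap_chains X n)" "b \<in> carrier (heap_chains X n)"
        "A = relclass n a" "B = relclass n b"
      by (auto simp: carrier_rel_chains)
    then show "rel_boundary X t e n (A \<otimes>\<^bsub>rel_chains X e n\<^esub> B) =
        rel_boundary X t e n A \<otimes>\<^bsub>rel_chains X e (n - 1)\<^esub> rel_boundary X t e n B"
      using heap_boundary_closed heap_chains_add_closed
      by (simp only: mult_relclass rel_boundary_relclass heap_boundary_add)
  qed
  show "rel_boundary X t e n (rel_boundary X t e (Suc n) A) = \<one>\<^bsub>rel_chains X e (n - 1)\<^esub>"
    if A: "A \<in> carrier (rel_chains X e (Suc n))" for A
  proof -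
    obtain c where c: "c \<in> carrier (heap_chains X (Suc n))" "A = relclass (Suc n) c"
      using A by (auto simp: carrier_rel_chains)
    then show ?thesis
      using heap_boundary_closed[OF c(1)] HC.square_zero[OF c(1)]
      by (simp add: rel_boundary_relclass relclass_0)
  qed
qed

sublocale RC: abelian_complex "rel_chains X e" "rel_boundary X t e"
  by (rule abelian_complex_rel)

lemma rel_cycles:
  "RC.cycles n =
    relclass n ` {c \<in> carrier (heap_chains X n). heap_boundary t n c \<in> hat_chains X e (n - 1)}"
proof -
  have "rel_boundary X t e n (relclass n c) = \<one>\<^bsub>rel_chains X e (n - 1)\<^esub>
      \<longleftrightarrow> heap_boundary t n c \<in> hat_chains X e (n - 1)" if "c \<in> carrier (heap_chains X n)" for c
    using that by (simp only: rel_boundary_relclass one_rel_chains relclass_eq_hat_iff)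
  then show ?thesis unfolding kernel_def carrier_rel_chains by blast
qed

lemma rel_boundaries:
  "boundaries (rel_chains X e) (rel_boundary X t e) n = relclass n ` boundaries (heap_chains X) (heap_boundary t) n"
  unfolding boundaries_def carrier_rel_chains image_image
  by (intro image_cong refl) (simp add: rel_boundary_relclass)

lemma carrier_rel_homology:
  "carrier (rel_homology X t e n) =
    (\<lambda>c. RC.hclass n (relclass n c)) `
      {c \<in> carrier (heap_chains X n). heap_boundary t n c \<in> hat_chains X e (n - 1)}"
  unfolding rel_homology_def RC.carrier_homology rel_cycles image_image ..

lemma relclass_hom: "relclass n \<in> hom (heap_chains X n) (rel_chains X e n)"
  by (rule homI) (auto simp: carrier_rel_chains mult_relclass)

lemma rel_proj_hclass:
  assumes "c \<in> carrier (heap_chains X n)"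
  shows "rel_proj X t e n (HC.hclass n c) = RC.hclass n (relclass n c)"
  unfolding rel_proj_def
  using assms by (intro induced_coset HC.comm RC.comm HC.subgroup_boundaries RC.subgroup_boundaries
      relclass_hom) (auto simp: rel_boundaries)

lemma group_hom_rel_proj: "group_hom (heap_homology X t n) (rel_homology X t e n) (rel_proj X t e n)"
  unfolding heap_homology_def rel_homology_def rel_proj_def
proof (rule hom_homology[OF abelian_complex_heap abelian_complex_rel relclass_hom])
  show "relclass n ` HC.cycles n \<subseteq> RC.cycles n"
    using subgroup.one_closed[OF subgroup_hat] unfolding rel_cycles by (auto simp: kernel_def)
  show "relclass n ` boundaries (heap_chains X) (heap_boundary t) n
      \<subseteq> boundaries (rel_chains X e) (rel_boundary X t e) n"
    by (simp add: rel_boundaries)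
qed

text \<open>
  In degree 2 a cycle \<open>z\<close> has \<open>\<epsilon>(z) = - \<epsilon>(\<partial> z) = 0\<close>, so the error term is absent.
\<close>

lemma Psi_cycle:
  assumes "2 \<le> n" and z: "z \<in> GC.cycles n"
  shows "Psi e z \<in> HC.cycles n"
proof -
  have keys: "Poly_Mapping.keys z \<subseteq> words X n" and z0: "group_boundary G n z = 0"
    using z by (auto simp: kernel_def carrier_group_chains)
  have "heap_boundary t n (Psi e z) = 0"
  proof (cases "n = 2")
    case True
    then have "collapse [e] z = 0"
      using collapse_group_boundary_2[of z "[e]"] keys z0 by simp
    then show ?thesis using True keys z0 by (simp add: Psi_boundary_2)
  next
    case False
    then show ?thesis using assms(1) keys z0 by (simp add: Psi_boundary)
  qed
  then show ?thesis
    using keys_Psi[OF _ keys] assms(1) by (simp add: kernel_def carrier_heap_chains)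
qed

lemma Psi_boundaries:
  assumes "2 \<le> n"
  shows "Psi e ` boundaries (group_chains G) (group_boundary G) n \<subseteq> boundaries (heap_chains X) (heap_boundary t) n"
proof -
  have "Psi e (group_boundary G (Suc n) v) \<in> heap_boundary t (Suc n) ` carrier (heap_chains X (Suc n))"
    if "v \<in> carrier (group_chains G (Suc n))" for v
    using that assms keys_Psi[of "Suc n" v] Psi_boundary[of "Suc n" v]
    by (intro image_eqI[of _ _ "Psi e v"]) (auto simp: carrier_group_chains carrier_heap_chains)
  then show ?thesis by (auto simp: boundaries_def)
qed

lemma Psi_hom: "1 \<le> n \<Longrightarrow> Psi e \<in> hom (group_chains G n) (heap_chains X n)"
  using keys_Psi[of n] unfolding group_chains_words heap_chains_def Psi_def
  by (intro frag_extend_hom) auto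

lemma group_hom_Psi_bar:
  assumes "2 \<le> n"
  shows "group_hom (group_homology G n) (heap_homology X t n) (Psi_bar X t e n)"
  unfolding group_homology_def heap_homology_def Psi_bar_def
  using assms Psi_cycle Psi_boundaries
  by (intro hom_homology abelian_complex_heap abelian_complex_group Psi_hom) auto

lemma Psi_bar_hclass:
  assumes "2 \<le> n" "v \<in> carrier (group_chains G n)"
  shows "Psi_bar X t e n (GC.hclass n v) = HC.hclass n (Psi e v)"
  unfolding Psi_bar_def using assms
  by (intro induced_coset HC.comm GC.comm GC.subgroup_boundaries HC.subgroup_boundaries Psi_hom
      Psi_boundaries) auto

text \<open>
  If \<open>Psi v = \<partial> c\<close>, then \<open>v = Phi (Psi v) = \<partial> (Phi c)\<close> from degree 2 on.  In degree 1 the chain \<open>Phi c\<close> has to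
  be corrected by a multiple of \<open>(e, e)\<close>.
\<close>

lemma Psi_reflects_boundaries:
  assumes n: "1 \<le> n" and v: "v \<in> carrier (group_chains G n)"
    and bd: "Psi e v \<in> boundaries (heap_chains X) (heap_boundary t) n"
  shows "v \<in> boundaries (group_chains G) (group_boundary G) n"
proof -
  obtain c where c: "Poly_Mapping.keys c \<subseteq> heap_tuples X (Suc n)" "Psi e v = heap_boundary t (Suc n) c"
    using bd by (auto simp: boundaries_def carrier_heap_chains)
  have Phi: "Poly_Mapping.keys (Phi t e c) \<subseteq> words X (Suc n)"
    using c n by (intro keys_Phi) auto
  show ?thesis
  proof (cases "n = 1")
    case True
    have "Psi e v = v"
    proof -
      have "Psi e v = frag_extend frag_of v"
        unfolding Psi_def
      proof (rule frag_extend_eq)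
        fix xs assume "xs \<in> Poly_Mapping.keys v"
        then have "length xs = 1" using v True by (auto simp: carrier_group_chains)
        then show "frag_of (intersperse e xs) = frag_of xs" by (auto simp: length_Suc_conv)
      qed
      then show ?thesis by (simp flip: frag_expansion)
    qed
    then have "v = group_boundary G 2 (Phi t e c - collapse [e, e] c)"
      using c True Phi_boundary_2[of c] group_boundary_collapse[of c]
      by (simp add: group_boundary_def frag_extend_diff numeral_2_eq_2)
    moreover have "Poly_Mapping.keys (Phi t e c - collapse [e, e] c) \<subseteq> words X 2"
    proof (intro keys_add_diff_subset)
      show "Poly_Mapping.keys (Phi t e c) \<subseteq> words X 2"
        using Phi True by (simp add: numeral_2_eq_2)
      show "Poly_Mapping.keys (collapse [e, e] c) \<subseteq> words X 2"
        unfolding collapse_def using base by (intro keys_frag_extend_subset[OF subset_refl]) auto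
    qed
    ultimately show ?thesis
      using True by (auto simp: boundaries_def carrier_group_chains numeral_2_eq_2)
  next
    case False
    then have "2 \<le> n" using n by simp
    then have "v = Phi t e (Psi e v)"
      using v by (simp add: Phi_Psi[of n] carrier_group_chains)
    also have "\<dots> = group_boundary G (Suc n) (Phi t e c)"
      using False n c by (simp add: Phi_boundary)
    finally show ?thesis using Phi by (auto simp: boundaries_def carrier_group_chains)
  qed
qed

text \<open>
  The argument compares the image sets element by element, so it also covers degree 1, where
  \<^const>\<open>Psi_bar\<close> takes unions of classes as values.
\<close>

lemma Psi_bar_inj:
  assumes n: "1 \<le> n"
  shows "inj_on (Psi_bar X t e n) (carrier (group_homology G n))"
proof (rule inj_onI)
  let ?B = "boundaries (group_chains G) (group_boundary G) n"
  let ?N = "boundaries (heap_chains X) (heap_boundary t) n"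
  fix A A' assume A: "A \<in> carrier (group_homology G n)" "A' \<in> carrier (group_homology G n)"
    and eq: "Psi_bar X t e n A = Psi_bar X t e n A'"
  obtain a a' where a: "a \<in> carrier (group_chains G n)" "A = GC.hclass n a"
    "a' \<in> carrier (group_chains G n)" "A' = GC.hclass n a'"
    using A by (auto simp: group_homology_def GC.carrier_homology kernel_def)
  have iff: "GC.hclass n v = GC.hclass n w \<longleftrightarrow> v - w \<in> ?B" for v w
    using r_coset_free_Abelian_group_eq_iff[of ?B "words X n" v w] GC.subgroup_boundaries[of n]
    by (simp add: group_chains_words)
  have cos: "GC.hclass n v = (\<lambda>b. b + v) ` ?B" for v
    unfolding group_chains_words r_coset_free_Abelian_group ..
  have "0 \<in> ?B" "0 \<in> ?N"
    using subgroup.one_closed[OF GC.subgroup_boundaries] subgroup.one_closed[OF HC.subgroup_boundaries]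
    by simp_all
  then have "Psi e a \<in> Psi_bar X t e n A"
    unfolding Psi_bar_def induced_def set_mult_def a(2) cos by force
  then obtain m b where mb: "m \<in> ?N" "b \<in> ?B" "Psi e a = m + Psi e (b + a')"
    unfolding eq a(4) cos by (auto simp: Psi_bar_def induced_def set_mult_def)
  have b: "b \<in> carrier (group_chains G n)" using mb(2) subgroup.subset[OF GC.subgroup_boundaries] by blast
  have "Psi e (a - (b + a')) = m" using mb(3) by (simp add: Psi_diff)
  moreover have "a - (b + a') \<in> carrier (group_chains G n)"
    using a(1,3) b unfolding carrier_group_chains by (intro keys_add_diff_subset)
  ultimately have "a - (b + a') \<in> ?B" using mb(1) n by (intro Psi_reflects_boundaries) auto
  then have "(a - (b + a')) + b \<in> ?B"
    using mb(2) subgroup.m_closed[OF GC.subgroup_boundaries[of n], unfolded mult_chains] by blast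
  moreover have "(a - (b + a')) + b = a - a'" by simp
  ultimately show "A = A'" by (simp add: a(2,4) iff)
qed

text \<open>
  In degree 3 the chain \<open>w\<close> with \<open>Psi w = \<partial> c\<close> is a cycle only up to \<open>\<epsilon>(w) (e)\<close>, and \<open>\<epsilon>(w) = \<epsilon>(\<partial> c) = 0\<close>.
\<close>

lemma Psi_preimage_of_boundary:
  assumes n: "1 \<le> n" and c: "c \<in> carrier (heap_chains X n)"
    and hat: "heap_boundary t n c \<in> hat_chains X e (n - 1)"
  obtains w where "w \<in> GC.cycles (n - 1)" "Psi e w = heap_boundary t n c"
proof (cases "n = 1")
  case True
  have "0 \<in> GC.cycles (n - 1)" using subgroup.one_closed[OF GC.subgroup_cycles[of "n - 1"]] by simp
  then show thesis using True by (intro that[of 0]) (simp_all add: heap_boundary_le_1)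
next
  case False
  then obtain w where w: "Poly_Mapping.keys w \<subseteq> words X (n - 1)" "Psi e w = heap_boundary t n c"
    using n hat by (auto simp: hat_chains_eq_Psi_image)
  have dd: "heap_boundary t (n - 1) (heap_boundary t n c) = 0"
    using c n HC.square_zero[of c "n - 1"] by simp
  consider "n = 2" | "n = 3" | "4 \<le> n" using n False by linarith
  then have "group_boundary G (n - 1) w = 0"
  proof cases
    case 1 then show ?thesis using w by (intro group_boundary_le_1) auto
  next
    case 2
    have "collapse [e] w = collapse [e] (Psi e w)" by (simp add: collapse_Psi)
    also have "\<dots> = 0" using w c 2 by (simp add: collapse_heap_boundary carrier_heap_chains)
    finally have "Psi e (group_boundary G 2 w) = Psi e 0"
      using dd w 2 Psi_boundary_2[of w] by simp
    then have "group_boundary G 2 w = 0" by (simp only: Psi_inject)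
    then show ?thesis using 2 by simp
  next
    case 3
    then have "Psi e (group_boundary G (n - 1) w) = Psi e 0"
      using dd w Psi_boundary[of "n - 1" w] by simp
    then show ?thesis by (simp only: Psi_inject)
  qed
  then show thesis using w by (intro that[of w]) (auto simp: kernel_def carrier_group_chains)
qed

text \<open>
  All chains in the class of \<open>c\<close> have the boundary of \<open>c\<close> up to boundaries of the subcomplex, and these
  pull back to group boundaries.  So the set in the definition of \<^const>\<open>connecting\<close> lies in one coset.
\<close>

lemma connecting_hclass:
  assumes n: "1 \<le> n" and c: "c \<in> carrier (heap_chains X n)"
    and w: "w \<in> carrier (group_chains G (n - 1))" "Psi e w = heap_boundary t n c"
  shows "connecting X t e n (RC.hclass n (relclass n c)) = GC.hclass (n - 1) w"
proof -
  let ?B = "boundaries (group_chains G) (group_boundary G) (n - 1)"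
  let ?U = "\<Union>(RC.hclass n (relclass n c))"
  let ?S = "{w' \<in> carrier (group_chains G (n - 1)). Psi e w' \<in> heap_boundary t n ` ?U}"
  have cos: "GC.hclass (n - 1) w = (\<lambda>b. b + w) ` ?B"
    unfolding group_chains_words r_coset_free_Abelian_group ..
  have rcos: "relclass n y = (\<lambda>h. h + y) ` hat_chains X e n" for y
    unfolding heap_chains_def r_coset_free_Abelian_group ..
  have "c \<in> ?U"
  proof
    show "relclass n c \<in> RC.hclass n (relclass n c)"
      using group.rcos_self[OF RC.group _ RC.subgroup_boundaries] c by (auto simp: carrier_rel_chains)
    show "c \<in> relclass n c"
      using group.rcos_self[OF HC.group c subgroup_hat] .
  qed
  then have wS: "w \<in> ?S" using w by auto
  have S: "?S \<subseteq> (\<lambda>b. b + w) ` ?B"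
  proof
    fix w' assume "w' \<in> ?S"
    then obtain y where w': "Psi e w' = heap_boundary t n y" and "y \<in> ?U" by auto
    then obtain d where d: "d \<in> boundaries (heap_chains X) (heap_boundary t) n"
        and "y \<in> relclass n d \<otimes>\<^bsub>rel_chains X e n\<^esub> relclass n c"
      by (auto simp: r_coset_def[of "rel_chains X e n"] rel_boundaries)
    moreover obtain b where b: "b \<in> carrier (heap_chains X (Suc n))" "d = heap_boundary t (Suc n) b"
      using d by (auto simp: boundaries_def)
    ultimately have "y \<in> relclass n (heap_boundary t (Suc n) b) \<otimes>\<^bsub>rel_chains X e n\<^esub> relclass n c"
      by simp
    then have "y \<in> relclass n (heap_boundary t (Suc n) b + c)"
      using mult_relclass[OF _ c] heap_boundary_closed[OF b(1)] by simp
    then obtain h where h: "h \<in> hat_chains X e n" "y = h + (heap_boundary t (Suc n) b + c)"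
      by (auto simp: rcos)
    obtain b' where b': "b' \<in> ?B" "heap_boundary t n h = Psi e b'"
      using Psi_boundary_mod[OF n h(1)] .
    have "Psi e w' = Psi e (b' + w)"
      using w' h(2) b'(2) w(2) HC.square_zero[OF b(1)] by (simp add: heap_boundary_add Psi_add)
    then show "w' \<in> (\<lambda>b. b + w) ` ?B" using b'(1) by (simp add: Psi_inject)
  qed
  have "?B <#>\<^bsub>group_chains G (n - 1)\<^esub> ?S = (\<lambda>b. b + w) ` ?B"
  proof
    show "?B <#>\<^bsub>group_chains G (n - 1)\<^esub> ?S \<subseteq> (\<lambda>b. b + w) ` ?B"
    proof
      fix y assume "y \<in> ?B <#>\<^bsub>group_chains G (n - 1)\<^esub> ?S"
      then obtain b s where b: "b \<in> ?B" "y = b + s" and "s \<in> ?S"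
        unfolding set_mult_def mult_chains by blast
      then obtain b' where b': "b' \<in> ?B" "s = b' + w"
        using S by blast
      have "b + b' \<in> ?B"
        using subgroup.m_closed[OF GC.subgroup_boundaries b(1) b'(1)] by simp
      moreover have "y = (b + b') + w" using b(2) b'(2) by (simp add: add.assoc)
      ultimately show "y \<in> (\<lambda>b. b + w) ` ?B" by blast
    qed
    show "(\<lambda>b. b + w) ` ?B \<subseteq> ?B <#>\<^bsub>group_chains G (n - 1)\<^esub> ?S"
      using wS unfolding set_mult_def mult_chains by blast
  qed
  then show ?thesis
    unfolding connecting_def Let_def cos .
qed

lemma group_hom_connecting:
  assumes n: "1 \<le> n"
  shows "group_hom (rel_homology X t e n) (group_homology G (n - 1)) (connecting X t e n)"
proof -
  have rep: "\<exists>c w. c \<in> carrier (heap_chains X n) \<and> Z = RC.hclass n (relclass n c)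
      \<and> w \<in> GC.cycles (n - 1) \<and> Psi e w = heap_boundary t n c"
    if "Z \<in> carrier (rel_homology X t e n)" for Z
    using that Psi_preimage_of_boundary[OF n] unfolding carrier_rel_homology by blast
  have cyc: "w \<in> carrier (group_chains G (n - 1))" if "w \<in> GC.cycles (n - 1)" for w
    using that by (simp add: kernel_def)
  have "connecting X t e n \<in> hom (rel_homology X t e n) (group_homology G (n - 1))"
  proof (rule homI)
    fix Z assume "Z \<in> carrier (rel_homology X t e n)"
    then obtain c w where "c \<in> carrier (heap_chains X n)" "Z = RC.hclass n (relclass n c)"
      "w \<in> GC.cycles (n - 1)" "Psi e w = heap_boundary t n c"
      using rep by blast
    then show "connecting X t e n Z \<in> carrier (group_homology G (n - 1))"
      using connecting_hclass[OF n] cyc by (auto simp: group_homology_def GC.carrier_homology)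
  next
    fix Z Z' assume "Z \<in> carrier (rel_homology X t e n)" "Z' \<in> carrier (rel_homology X t e n)"
    then obtain c w c' w' where
      c: "c \<in> carrier (heap_chains X n)" "Z = RC.hclass n (relclass n c)"
        "w \<in> GC.cycles (n - 1)" "Psi e w = heap_boundary t n c" and
      c': "c' \<in> carrier (heap_chains X n)" "Z' = RC.hclass n (relclass n c')"
        "w' \<in> GC.cycles (n - 1)" "Psi e w' = heap_boundary t n c'"
      using rep by meson
    have sum: "c + c' \<in> carrier (heap_chains X n)" "w + w' \<in> carrier (group_chains G (n - 1))"
      using c(1) c'(1) cyc[OF c(3)] cyc[OF c'(3)]
      by (simp_all only: heap_chains_add_closed group_chains_add_closed)
    have "Z \<otimes>\<^bsub>rel_homology X t e n\<^esub> Z' = RC.hclass n (relclass n (c + c'))"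
      using c c' by (simp add: rel_homology_def RC.mult_homology mult_relclass carrier_rel_chains)
    then have "connecting X t e n (Z \<otimes>\<^bsub>rel_homology X t e n\<^esub> Z') = GC.hclass (n - 1) (w + w')"
      using connecting_hclass[OF n sum] c(4) c'(4) by (simp add: Psi_add heap_boundary_add)
    also have "\<dots> = connecting X t e n Z \<otimes>\<^bsub>group_homology G (n - 1)\<^esub> connecting X t e n Z'"
      using connecting_hclass[OF n c(1) cyc[OF c(3)] c(4)] connecting_hclass[OF n c'(1) cyc[OF c'(3)] c'(4)]
        c(2,3) c'(2,3) cyc by (simp add: group_homology_def GC.mult_homology)
    finally show "connecting X t e n (Z \<otimes>\<^bsub>rel_homology X t e n\<^esub> Z')
        = connecting X t e n Z \<otimes>\<^bsub>group_homology G (n - 1)\<^esub> connecting X t e n Z'" .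
  qed
  then show ?thesis
    using RC.group_homology GC.group_homology
    by (simp add: group_hom_def group_hom_axioms_def rel_homology_def group_homology_def)
qed

lemma hclass_representative:
  assumes "A \<in> carrier (group_homology G n)"
  obtains z where "z \<in> GC.cycles n" "z \<in> carrier (group_chains G n)" "A = GC.hclass n z"
  using assms by (auto simp: group_homology_def GC.carrier_homology kernel_def)

lemma heap_hclass_representative:
  assumes "A \<in> carrier (heap_homology X t n)"
  obtains c where "c \<in> HC.cycles n" "c \<in> carrier (heap_chains X n)" "heap_boundary t n c = 0"
    "A = HC.hclass n c"
  using assms by (auto simp: heap_homology_def HC.carrier_homology kernel_def)

lemma rel_hclass_representative:
  assumes "1 \<le> n" "Z \<in> carrier (rel_homology X t e n)"
  obtains c w where "c \<in> carrier (heap_chains X n)" "heap_boundary t n c \<in> hat_chains X e (n - 1)"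
    "Z = RC.hclass n (relclass n c)"
    "w \<in> GC.cycles (n - 1)" "w \<in> carrier (group_chains G (n - 1))" "Psi e w = heap_boundary t n c"
proof -
  obtain c where c: "c \<in> carrier (heap_chains X n)" "heap_boundary t n c \<in> hat_chains X e (n - 1)"
      "Z = RC.hclass n (relclass n c)"
    using assms(2) unfolding carrier_rel_homology by blast
  obtain w where w: "w \<in> GC.cycles (n - 1)" "Psi e w = heap_boundary t n c"
    using Psi_preimage_of_boundary[OF assms(1) c(1,2)] .
  show thesis using that[OF c w(1) _ w(2)] w(1) by (simp add: kernel_def)
qed

lemma rel_hclass_eq_one_iff:
  assumes "c \<in> carrier (heap_chains X n)"
  shows "RC.hclass n (relclass n c) = \<one>\<^bsub>rel_homology X t e n\<^esub> \<longleftrightarrow>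
    (\<exists>b \<in> boundaries (heap_chains X) (heap_boundary t) n. c - b \<in> hat_chains X e n)"
proof -
  have "RC.hclass n (relclass n c) = \<one>\<^bsub>rel_homology X t e n\<^esub> \<longleftrightarrow>
      relclass n c \<in> relclass n ` boundaries (heap_chains X) (heap_boundary t) n"
    using assms RC.hclass_eq_one_iff[of "relclass n c" n]
    by (simp add: rel_homology_def RC.one_homology rel_boundaries carrier_rel_chains)
  then show ?thesis by (auto simp: relclass_eq_iff image_iff)
qed

lemma heap_hclass_eq_iff:
  "HC.hclass n c = HC.hclass n c' \<longleftrightarrow> c - c' \<in> boundaries (heap_chains X) (heap_boundary t) n"
  using r_coset_free_Abelian_group_eq_iff[of "boundaries (heap_chains X) (heap_boundary t) n"
      "heap_tuples X n" c c'] HC.subgroup_boundaries[of n]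
  by (simp add: heap_chains_def[of X n])

lemma group_hclass_eq_one_iff:
  assumes "w \<in> carrier (group_chains G n)"
  shows "GC.hclass n w = \<one>\<^bsub>group_homology G n\<^esub> \<longleftrightarrow> w \<in> boundaries (group_chains G) (group_boundary G) n"
  using assms by (simp add: group_homology_def GC.one_homology GC.hclass_eq_one_iff)

lemma heap_hclass_eq_one_iff:
  assumes "c \<in> carrier (heap_chains X n)"
  shows "HC.hclass n c = \<one>\<^bsub>heap_homology X t n\<^esub> \<longleftrightarrow> c \<in> boundaries (heap_chains X) (heap_boundary t) n"
  using assms by (simp add: heap_homology_def HC.one_homology HC.hclass_eq_one_iff)

lemma Psi_in_hat: "1 \<le> n \<Longrightarrow> v \<in> carrier (group_chains G n) \<Longrightarrow> Psi e v \<in> hat_chains X e n"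
  by (auto simp: hat_chains_eq_Psi_image carrier_group_chains)

lemma Psi_closed: "1 \<le> n \<Longrightarrow> v \<in> carrier (group_chains G n) \<Longrightarrow> Psi e v \<in> carrier (heap_chains X n)"
  using Psi_in_hat hat_closed by blast

lemma zero_in_boundaries: "0 \<in> boundaries (heap_chains X) (heap_boundary t) n"
  using subgroup.one_closed[OF HC.subgroup_boundaries] by simp

lemma image_Psi_bar_subset_kernel:
  assumes "2 \<le> n"
  shows "Psi_bar X t e n ` carrier (group_homology G n)
    \<subseteq> kernel (heap_homology X t n) (rel_homology X t e n) (rel_proj X t e n)"
proof
  fix B assume "B \<in> Psi_bar X t e n ` carrier (group_homology G n)"
  then obtain A where A: "A \<in> carrier (group_homology G n)" "B = Psi_bar X t e n A" by blast
  obtain z where z: "z \<in> carrier (group_chains G n)" "A = GC.hclass n z"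
    using A(1) by (rule hclass_representative)
  have Pz: "Psi e z \<in> hat_chains X e n" "Psi e z \<in> carrier (heap_chains X n)"
    using Psi_in_hat[OF _ z(1)] Psi_closed[OF _ z(1)] assms by auto
  have B: "B = HC.hclass n (Psi e z)" using A(2) z assms by (simp add: Psi_bar_hclass)
  have "B \<in> carrier (heap_homology X t n)"
    using group_hom.hom_closed[OF group_hom_Psi_bar[OF assms] A(1)] A(2) by simp
  moreover have "rel_proj X t e n B = \<one>\<^bsub>rel_homology X t e n\<^esub>"
    unfolding B rel_proj_hclass[OF Pz(2)] rel_hclass_eq_one_iff[OF Pz(2)]
    using Pz(1) zero_in_boundaries by (intro bexI[of _ 0]) auto
  ultimately show "B \<in> kernel (heap_homology X t n) (rel_homology X t e n) (rel_proj X t e n)"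
    by (simp add: kernel_def)
qed

text \<open>
  A heap cycle that bounds relatively differs by a boundary from some \<open>Psi v\<close> with \<open>Psi (\<partial> v) = 0\<close>, and
  \<^const>\<open>Psi\<close> is injective.  In degree 2 this last step fails: \<open>Psi (e, e) = (e, e, e)\<close> is a cycle while
  \<open>(e, e)\<close> is not.
\<close>

lemma exact_at_heap_homology:
  assumes n: "3 \<le> n"
  shows "exact_at (group_homology G n) (Psi_bar X t e n)
    (heap_homology X t n) (rel_proj X t e n) (rel_homology X t e n)"
  unfolding exact_at_def
proof (intro conjI equalityI group_hom_rel_proj)
  show "group_hom (group_homology G n) (heap_homology X t n) (Psi_bar X t e n)"
    using n by (intro group_hom_Psi_bar) simp
  show "Psi_bar X t e n ` carrier (group_homology G n)
      \<subseteq> kernel (heap_homology X t n) (rel_homology X t e n) (rel_proj X t e n)"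
    using n by (intro image_Psi_bar_subset_kernel) simp
  show "kernel (heap_homology X t n) (rel_homology X t e n) (rel_proj X t e n)
      \<subseteq> Psi_bar X t e n ` carrier (group_homology G n)"
  proof
    fix A assume "A \<in> kernel (heap_homology X t n) (rel_homology X t e n) (rel_proj X t e n)"
    then have A: "A \<in> carrier (heap_homology X t n)" "rel_proj X t e n A = \<one>\<^bsub>rel_homology X t e n\<^esub>"
      by (simp_all add: kernel_def)
    obtain c where c: "c \<in> carrier (heap_chains X n)" "heap_boundary t n c = 0" "A = HC.hclass n c"
      using A(1) by (rule heap_hclass_representative)
    obtain b where b: "b \<in> boundaries (heap_chains X) (heap_boundary t) n" "c - b \<in> hat_chains X e n"
      using A(2) unfolding c(3) rel_proj_hclass[OF c(1)] rel_hclass_eq_one_iff[OF c(1)] by blast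
    obtain v where v: "v \<in> carrier (group_chains G n)" "c - b = Psi e v"
      using b(2) n by (auto simp: hat_chains_eq_Psi_image carrier_group_chains)
    have "heap_boundary t n b = 0"
      using subsetD[OF HC.boundaries_subset_cycles b(1)] by (simp add: kernel_def)
    then have "heap_boundary t n (Psi e v) = 0"
      using c(2) by (simp add: heap_boundary_diff flip: v(2))
    then have "Psi e (group_boundary G n v) = Psi e 0"
      using n v(1) by (simp add: Psi_boundary carrier_group_chains)
    then have "group_boundary G n v = 0" by (simp only: Psi_inject)
    then have "v \<in> GC.cycles n" using v(1) by (simp add: kernel_def)
    then have "GC.hclass n v \<in> carrier (group_homology G n)"
      by (simp add: group_homology_def GC.carrier_homology)
    moreover have "A = Psi_bar X t e n (GC.hclass n v)"
    proof -
      have "c - Psi e v = b" using v(2) by (simp add: algebra_simps)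
      then show ?thesis
        using n v(1) b(1) by (simp add: c(3) Psi_bar_hclass heap_hclass_eq_iff)
    qed
    ultimately show "A \<in> Psi_bar X t e n ` carrier (group_homology G n)" by blast
  qed
qed

text \<open>
  From degree 2 on take \<open>h = Psi v\<close> with \<open>w = \<partial> v\<close>.  In degree 2 it has the right boundary because
  \<open>\<epsilon>(v) = - \<epsilon>(w) = - \<epsilon>(\<partial> c) = 0\<close>.
\<close>

lemma boundary_lifts_to_hat:
  assumes n: "1 \<le> n" and c: "c \<in> carrier (heap_chains X n)" "Psi e w = heap_boundary t n c"
    and w: "w \<in> boundaries (group_chains G) (group_boundary G) (n - 1)"
  obtains h where "h \<in> hat_chains X e n" "heap_boundary t n h = heap_boundary t n c"
proof -
  obtain v where v: "v \<in> carrier (group_chains G n)" "w = group_boundary G n v"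
    using w n by (auto simp: boundaries_def)
  consider "n = 1" | "n = 2" | "3 \<le> n" using n by linarith
  then show thesis
  proof cases
    case 1
    then show thesis
      using that[of 0] subgroup.one_closed[OF subgroup_hat[of n]] by (simp add: heap_boundary_le_1)
  next
    case 2
    have keys: "Poly_Mapping.keys v \<subseteq> words X 2" using v(1) 2 by (simp add: carrier_group_chains)
    have "- collapse [e] v = collapse [e] (Psi e w)"
      using collapse_group_boundary_2[OF keys, of "[e]"] v(2) 2 by (simp add: collapse_Psi)
    also have "\<dots> = 0"
      using c 2 by (simp add: collapse_heap_boundary carrier_heap_chains)
    finally have "heap_boundary t n (Psi e v) = Psi e w"
      using Psi_boundary_2[OF keys] v(2) 2 by simp
    then show thesis using that[of "Psi e v"] Psi_in_hat[OF n v(1)] c(2) by simp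
  next
    case 3
    then have "heap_boundary t n (Psi e v) = Psi e w"
      using v by (simp add: Psi_boundary carrier_group_chains)
    then show thesis using that[of "Psi e v"] Psi_in_hat[OF n v(1)] c(2) by simp
  qed
qed

lemma exact_at_rel_homology:
  assumes n: "1 \<le> n"
  shows "exact_at (heap_homology X t n) (rel_proj X t e n)
    (rel_homology X t e n) (connecting X t e n) (group_homology G (n - 1))"
  unfolding exact_at_def
proof (intro conjI equalityI group_hom_rel_proj group_hom_connecting n)
  show "rel_proj X t e n ` carrier (heap_homology X t n)
      \<subseteq> kernel (rel_homology X t e n) (group_homology G (n - 1)) (connecting X t e n)"
  proof
    fix Z assume "Z \<in> rel_proj X t e n ` carrier (heap_homology X t n)"
    then obtain A where A: "A \<in> carrier (heap_homology X t n)" "Z = rel_proj X t e n A" by blast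
    obtain c where c: "c \<in> carrier (heap_chains X n)" "heap_boundary t n c = 0" "A = HC.hclass n c"
      using A(1) by (rule heap_hclass_representative)
    have 0: "0 \<in> carrier (group_chains G (n - 1))" "Psi e 0 = heap_boundary t n c"
      using c(2) by (simp_all add: carrier_group_chains)
    have "connecting X t e n Z = GC.hclass (n - 1) 0"
      unfolding A(2) c(3) rel_proj_hclass[OF c(1)] by (rule connecting_hclass[OF n c(1) 0])
    also have "\<dots> = \<one>\<^bsub>group_homology G (n - 1)\<^esub>"
      unfolding group_hclass_eq_one_iff[OF 0(1)]
      using subgroup.one_closed[OF GC.subgroup_boundaries[of "n - 1"]] by simp
    finally show "Z \<in> kernel (rel_homology X t e n) (group_homology G (n - 1)) (connecting X t e n)"
      using group_hom.hom_closed[OF group_hom_rel_proj A(1)] A(2) by (simp add: kernel_def)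
  qed
  show "kernel (rel_homology X t e n) (group_homology G (n - 1)) (connecting X t e n)
      \<subseteq> rel_proj X t e n ` carrier (heap_homology X t n)"
  proof
    fix Z assume "Z \<in> kernel (rel_homology X t e n) (group_homology G (n - 1)) (connecting X t e n)"
    then have Z: "Z \<in> carrier (rel_homology X t e n)"
        "connecting X t e n Z = \<one>\<^bsub>group_homology G (n - 1)\<^esub>"
      by (simp_all add: kernel_def)
    obtain c w where c: "c \<in> carrier (heap_chains X n)" "Z = RC.hclass n (relclass n c)"
        and w: "w \<in> carrier (group_chains G (n - 1))" "Psi e w = heap_boundary t n c"
      using n Z(1) by (rule rel_hclass_representative)
    have "w \<in> boundaries (group_chains G) (group_boundary G) (n - 1)"
      using Z(2) unfolding c(2) connecting_hclass[OF n c(1) w] group_hclass_eq_one_iff[OF w(1)] .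
    then obtain h where h: "h \<in> hat_chains X e n" "heap_boundary t n h = heap_boundary t n c"
      using boundary_lifts_to_hat[OF n c(1) w(2)] by blast
    have ch: "c - h \<in> carrier (heap_chains X n)"
      using c(1) hat_closed[OF h(1)] by (rule heap_chains_add_closed)
    then have "c - h \<in> HC.cycles n" using h(2) by (simp add: kernel_def heap_boundary_diff)
    then have "HC.hclass n (c - h) \<in> carrier (heap_homology X t n)"
      by (simp add: heap_homology_def HC.carrier_homology)
    moreover have "relclass n c = relclass n (c - h)" using h(1) by (simp add: relclass_eq_iff)
    then have "Z = rel_proj X t e n (HC.hclass n (c - h))"
      by (simp only: c(2) rel_proj_hclass[OF ch])
    ultimately show "Z \<in> rel_proj X t e n ` carrier (heap_homology X t n)" by blast
  qed
qed

lemma exact_at_group_homology: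
  assumes n: "2 \<le> n"
  shows "exact_at (rel_homology X t e (n + 1)) (connecting X t e (n + 1))
    (group_homology G n) (Psi_bar X t e n) (heap_homology X t n)"
  unfolding exact_at_def
proof (intro conjI equalityI group_hom_Psi_bar n)
  show "group_hom (rel_homology X t e (n + 1)) (group_homology G n) (connecting X t e (n + 1))"
    using group_hom_connecting[of "n + 1"] by simp
  show "connecting X t e (n + 1) ` carrier (rel_homology X t e (n + 1))
      \<subseteq> kernel (group_homology G n) (heap_homology X t n) (Psi_bar X t e n)"
  proof
    fix A assume "A \<in> connecting X t e (n + 1) ` carrier (rel_homology X t e (n + 1))"
    then obtain Z where Z: "Z \<in> carrier (rel_homology X t e (n + 1))" "A = connecting X t e (n + 1) Z"
      by blast
    obtain c w where c: "c \<in> carrier (heap_chains X (n + 1))" "Z = RC.hclass (n + 1) (relclass (n + 1) c)"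
        and w: "w \<in> GC.cycles (n + 1 - 1)" "w \<in> carrier (group_chains G (n + 1 - 1))"
          "Psi e w = heap_boundary t (n + 1) c"
      using _ Z(1) by (rule rel_hclass_representative) simp
    have w': "w \<in> GC.cycles n" "w \<in> carrier (group_chains G n)" using w by simp_all
    have A: "A = GC.hclass n w"
      using connecting_hclass[OF _ c(1) w(2,3)] Z(2) c(2) by simp
    have "Psi e w \<in> boundaries (heap_chains X) (heap_boundary t) n"
      using w(3) c(1) by (simp add: boundaries_def)
    then have "Psi_bar X t e n A = \<one>\<^bsub>heap_homology X t n\<^esub>"
      using n w'(2) Psi_closed[of n w] by (simp add: A Psi_bar_hclass heap_hclass_eq_one_iff)
    moreover have "A \<in> carrier (group_homology G n)"
      using w'(1) by (simp add: A group_homology_def GC.carrier_homology)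
    ultimately show "A \<in> kernel (group_homology G n) (heap_homology X t n) (Psi_bar X t e n)"
      unfolding kernel_def by blast
  qed
  show "kernel (group_homology G n) (heap_homology X t n) (Psi_bar X t e n)
      \<subseteq> connecting X t e (n + 1) ` carrier (rel_homology X t e (n + 1))"
  proof
    fix A assume "A \<in> kernel (group_homology G n) (heap_homology X t n) (Psi_bar X t e n)"
    then have A: "A \<in> carrier (group_homology G n)" "Psi_bar X t e n A = \<one>\<^bsub>heap_homology X t n\<^esub>"
      by (simp_all add: kernel_def)
    obtain z where z: "z \<in> carrier (group_chains G n)" "A = GC.hclass n z"
      using A(1) by (rule hclass_representative)
    have "Psi e z \<in> boundaries (heap_chains X) (heap_boundary t) n"
      using A(2) n z Psi_closed[of n z] by (simp add: Psi_bar_hclass heap_hclass_eq_one_iff)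
    then obtain c where c: "c \<in> carrier (heap_chains X (n + 1))" "Psi e z = heap_boundary t (n + 1) c"
      by (auto simp: boundaries_def)
    have "heap_boundary t (n + 1) c \<in> hat_chains X e (n + 1 - 1)"
      using Psi_in_hat[of n z] n z(1) c(2) by simp
    then have "RC.hclass (n + 1) (relclass (n + 1) c) \<in> carrier (rel_homology X t e (n + 1))"
      using c(1) unfolding carrier_rel_homology by blast
    moreover have "A = connecting X t e (n + 1) (RC.hclass (n + 1) (relclass (n + 1) c))"
      using connecting_hclass[OF _ c(1) _ c(2)] z by simp
    ultimately show "A \<in> connecting X t e (n + 1) ` carrier (rel_homology X t e (n + 1))" by blast
  qed
qed

end

theorem theorem4p3:
  fixes X :: "'a set" and t :: "'a \<Rightarrow> 'a \<Rightarrow> 'a \<Rightarrow> 'a" and e :: 'a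
  assumes "heap X t" and "e \<in> X"
  shows
    "(\<forall>n\<ge>2. group_hom (group_homology (heap_group X t e) n) (heap_homology X t n) (Psi_bar X t e n))
   \<and> (\<forall>n\<ge>1. inj_on (Psi_bar X t e n) (carrier (group_homology (heap_group X t e) n)))
   \<and> (\<forall>n\<ge>3. exact_at (group_homology (heap_group X t e) n) (Psi_bar X t e n)
                     (heap_homology X t n) (rel_proj X t e n)
                     (rel_homology X t e n))
   \<and> Psi_bar X t e 2 ` carrier (group_homology (heap_group X t e) 2)
       \<subseteq> kernel (heap_homology X t 2) (rel_homology X t e 2) (rel_proj X t e 2)
   \<and> (\<forall>n\<ge>1. exact_at (heap_homology X t n) (rel_proj X t e n)
                     (rel_homology X t e n) (connecting X t e n)
                     (group_homology (heap_group X t e) (n - 1)))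
   \<and> (\<forall>n\<ge>2. exact_at (rel_homology X t e (n + 1)) (connecting X t e (n + 1))
                     (group_homology (heap_group X t e) n) (Psi_bar X t e n)
                     (heap_homology X t n))"
proof -
  interpret pointed_heap X t e
    using assms by (simp add: pointed_heap_def pointed_heap_axioms_def)
  show ?thesis
    using group_hom_Psi_bar Psi_bar_inj exact_at_heap_homology image_Psi_bar_subset_kernel[of 2]
      exact_at_rel_homology exact_at_group_homology
    by blast
qed

end
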